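(* Let $\sigma$ be any one of the signatures $(\dot\cup)$, $(\dot\smile)$, $(\dot\cup,\emptyset)$, $(\dot\smile,\emptyset)$, $(\dot\smile,\mid)$ or $(\dot\smile,\mid,\emptyset)$. The class of $\sigma$-representable partial algebras is not finitely axiomatisable in the first-order language $\mathcal L(J)$, $\mathcal L(J,0)$, $\mathcal L(J,;)$ or $\mathcal L(J,;,0)$, as appropriate to $\sigma$.
   Context: For sets $S,T$, the disjoint union $S\mathbin{\dot\cup}T$ equals $S\cup T$ if $S\cap T=\emptyset$, and is undefined otherwise. A partial function is a functional set of ordered pairs. For partial functions $f,g$, the domain-disjoint union $f\mathbin{\dot\smile}g$ equals $f\cup g$ if the domains of $f$ and $g$ are disjoint, and is undefined otherwise; $f\mid g$ denotes the (total operation of) composition of partial functions; $\emptyset$ denotes the constant empty set. A partial algebra is a (possibly empty) set together with a sequence of partial operations of finite arities. An isomorphism between similar partial algebras is a bijection $\theta$ such that for each operation $\Omega$ and corresponding operation $\Pi$, $\Omega(a_1,\dots,a_k)$ is defined if and only if $\Pi(\theta(a_1),\dots,\theta(a_k))$ is defined, and then $\theta(\Omega(a_1,\dots,a_k))=\Pi(\theta(a_1),\dots,\theta(a_k))$. For $\sigma$ containing $\dot\cup$, a partial $\sigma$-algebra of sets is a subset of $\wp(X)$, for some set $X$, closed under $\dot\cup$ wherever defined and containing $\emptyset$ if $\emptyset$ is in $\sigma$; for $\sigma$ containing $\dot\smile$, a partial $\sigma$-algebra of partial functions is a set of partial functions closed under the operations in $\sigma$ wherever defined and containing $\emptyset$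 if $\emptyset$ is in $\sigma$. A partial algebra is $\sigma$-representable if it is isomorphic to a partial $\sigma$-algebra of sets (if $\dot\cup$ is in $\sigma$), respectively of partial functions (if $\dot\smile$ is in $\sigma$). The abstract symbol corresponding to $\dot\cup$ or $\dot\smile$ is $\dot\sqcup$, that for $\mid$ is $;$ and that for $\emptyset$ is $0$. In the first-order languages (with equality), $\dot\sqcup$ is replaced by a ternary relation symbol $J$, with $J(a,b,c)$ iff $a\mathbin{\dot\sqcup}b$ is defined and equal to $c$; $;$ is a binary function symbol and $0$ a constant symbol. *)

theory Defs
  imports Main
begin

section \<open>Signatures\<close>

text \<open>The operations on sets and on partial functions, and the abstract symbols corresponding
  to them.  A signature never repeats a symbol, so it is given as a set.\<close>

datatype conc_sym = DisjUnion | DomDisjUnion | Compose | EmptySet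

datatype abs_sym = Join | Semi | Zero

fun abstract_sym :: "conc_sym \<Rightarrow> abs_sym" where
  "abstract_sym DisjUnion = Join"
| "abstract_sym DomDisjUnion = Join"
| "abstract_sym Compose = Semi"
| "abstract_sym EmptySet = Zero"

fun arity :: "abs_sym \<Rightarrow> nat" where
  "arity Join = 2"
| "arity Semi = 2"
| "arity Zero = 0"

section \<open>Partial algebras and isomorphism\<close>

record 'a palg =
  pa_univ :: "'a set"
  pa_oper :: "abs_sym \<Rightarrow> 'a list \<Rightarrow> 'a option"

text \<open>\<open>None\<close> means undefined.  The universe may be empty.  Only the values of \<open>pa_oper\<close> at symbols
  in \<open>S\<close> and at lists over the universe of the right length are relevant.  If \<open>pa_oper\<close> is
  inherited from a larger set, this predicate says that the universe is closed under the
  operations in \<open>S\<close> wherever they are defined; for a constant, that it belongs to the universe.\<close>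

definition partial_algebra :: "abs_sym set \<Rightarrow> 'a palg \<Rightarrow> bool" where
  "partial_algebra S A \<longleftrightarrow>
     (\<forall>s\<in>S. \<forall>xs y. length xs = arity s \<and> set xs \<subseteq> pa_univ A \<and> pa_oper A s xs = Some y \<longrightarrow> y \<in> pa_univ A)"

definition palg_iso :: "abs_sym set \<Rightarrow> ('a \<Rightarrow> 'b) \<Rightarrow> 'a palg \<Rightarrow> 'b palg \<Rightarrow> bool" where
  "palg_iso S \<theta> A B \<longleftrightarrow>
     bij_betw \<theta> (pa_univ A) (pa_univ B) \<and>
     (\<forall>s\<in>S. \<forall>xs. length xs = arity s \<and> set xs \<subseteq> pa_univ A \<longrightarrow>
        (pa_oper A s xs \<noteq> None \<longleftrightarrow> pa_oper B s (map \<theta> xs) \<noteq> None) \<and>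
        (\<forall>y. pa_oper A s xs = Some y \<longrightarrow> pa_oper B s (map \<theta> xs) = Some (\<theta> y)))"

definition palg_isomorphic :: "abs_sym set \<Rightarrow> 'a palg \<Rightarrow> 'b palg \<Rightarrow> bool" where
  "palg_isomorphic S A B \<longleftrightarrow> (\<exists>\<theta>. palg_iso S \<theta> A B)"

section \<open>Partial algebras of sets and of partial functions\<close>

fun set_oper :: "abs_sym \<Rightarrow> 'b set list \<Rightarrow> 'b set option" where
  "set_oper Join [X, Y] = (if X \<inter> Y = {} then Some (X \<union> Y) else None)"
| "set_oper Zero [] = Some {}"
| "set_oper _ _ = None"

definition palg_of_sets :: "conc_sym set \<Rightarrow> 'b set palg \<Rightarrow> bool" where
  "palg_of_sets \<sigma> B \<longleftrightarrow>
     (\<exists>X. pa_univ B \<subseteq> Pow X) \<and> pa_oper B = set_oper \<and> partial_algebra (abstract_sym ` \<sigma>) B"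

text \<open>Partial functions are functional sets of ordered pairs.  In the composition \<open>f O g\<close> the
  left-hand function is applied first.\<close>

fun pfun_oper :: "abs_sym \<Rightarrow> ('b \<times> 'b) set list \<Rightarrow> ('b \<times> 'b) set option" where
  "pfun_oper Join [f, g] = (if Domain f \<inter> Domain g = {} then Some (f \<union> g) else None)"
| "pfun_oper Semi [f, g] = Some (f O g)"
| "pfun_oper Zero [] = Some {}"
| "pfun_oper _ _ = None"

definition palg_of_pfuns :: "conc_sym set \<Rightarrow> ('b \<times> 'b) set palg \<Rightarrow> bool" where
  "palg_of_pfuns \<sigma> B \<longleftrightarrow>
     (\<forall>f\<in>pa_univ B. single_valued f) \<and> pa_oper B = pfun_oper \<and> partial_algebra (abstract_sym ` \<sigma>) B"

text \<open>The type \<open>'b\<close> is the universe from which the points of the base are taken.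
  Lemma \<open>representable_base_irrelevant\<close> below shows that it is immaterial as soon as
  the infinite type \<open>'a\<close> embeds into it.\<close>

definition representable :: "'b itself \<Rightarrow> conc_sym set \<Rightarrow> 'a palg \<Rightarrow> bool" where
  "representable (_ :: 'b itself) \<sigma> A \<longleftrightarrow>
     partial_algebra (abstract_sym ` \<sigma>) A \<and>
     (DisjUnion \<in> \<sigma> \<and>
        (\<exists>B :: 'b set palg. palg_of_sets \<sigma> B \<and> palg_isomorphic (abstract_sym ` \<sigma>) A B) \<or>
      DomDisjUnion \<in> \<sigma> \<and>
        (\<exists>B :: ('b \<times> 'b) set palg. palg_of_pfuns \<sigma> B \<and> palg_isomorphic (abstract_sym ` \<sigma>) A B))"

section \<open>Independence of the universe for the base\<close>

lemma palg_iso_trans: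
  assumes "palg_iso S \<theta> A B" "palg_iso S h B C"
  shows "palg_iso S (h \<circ> \<theta>) A C"
proof -
  have bij: "bij_betw \<theta> (pa_univ A) (pa_univ B)" "bij_betw h (pa_univ B) (pa_univ C)"
    using assms by (auto simp: palg_iso_def)
  have "(pa_oper A s xs \<noteq> None \<longleftrightarrow> pa_oper C s (map (h \<circ> \<theta>) xs) \<noteq> None) \<and>
        (\<forall>y. pa_oper A s xs = Some y \<longrightarrow> pa_oper C s (map (h \<circ> \<theta>) xs) = Some ((h \<circ> \<theta>) y))"
    if s: "s \<in> S" "length xs = arity s" "set xs \<subseteq> pa_univ A" for s xs
  proof -
    have m: "length (map \<theta> xs) = arity s" "set (map \<theta> xs) \<subseteq> pa_univ B"
      using s bij by (auto simp: bij_betw_def)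
    have 1: "(pa_oper A s xs \<noteq> None \<longleftrightarrow> pa_oper B s (map \<theta> xs) \<noteq> None) \<and>
        (\<forall>y. pa_oper A s xs = Some y \<longrightarrow> pa_oper B s (map \<theta> xs) = Some (\<theta> y))"
      using assms(1) s unfolding palg_iso_def by blast
    have 2: "(pa_oper B s (map \<theta> xs) \<noteq> None \<longleftrightarrow> pa_oper C s (map h (map \<theta> xs)) \<noteq> None) \<and>
        (\<forall>y. pa_oper B s (map \<theta> xs) = Some y \<longrightarrow> pa_oper C s (map h (map \<theta> xs)) = Some (h y))"
      using assms(2) s(1) m unfolding palg_iso_def by blast
    show ?thesis using 1 2 by auto
  qed
  then show ?thesis
    using bij bij_betw_trans unfolding palg_iso_def by blast
qed

lemma palg_iso_image:
  assumes "partial_algebra S B" "inj_on h (pa_univ B)" "pa_univ C = h ` pa_univ B"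
    and op: "\<And>s xs. s \<in> S \<Longrightarrow> length xs = arity s \<Longrightarrow> set xs \<subseteq> pa_univ B \<Longrightarrow>
           pa_oper C s (map h xs) = map_option h (pa_oper B s xs)"
  shows "palg_iso S h B C" "partial_algebra S C"
proof -
  show "palg_iso S h B C"
    unfolding palg_iso_def using assms(2,3) op by (auto simp: bij_betw_def)
  show "partial_algebra S C"
    unfolding partial_algebra_def
  proof (intro ballI allI impI, elim conjE)
    fix s ys y
    assume s: "s \<in> S" and len: "length ys = arity s" and ys: "set ys \<subseteq> pa_univ C"
      and y: "pa_oper C s ys = Some y"
    have "\<exists>xs. ys = map h xs \<and> set xs \<subseteq> pa_univ B"
      using ys unfolding assms(3) by (induction ys) (auto, metis list.simps(9) insert_subset list.simps(15))
    then obtain xs where xs: "ys = map h xs" "set xs \<subseteq> pa_univ B" by blast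
    then obtain z where "pa_oper B s xs = Some z" "y = h z"
      using op[OF s _ xs(2)] len y by auto
    then show "y \<in> pa_univ C"
      using assms(1,3) s len xs unfolding partial_algebra_def by auto
  qed
qed

lemma inj_encoding:
  includes cardinal_syntax
  assumes "infinite (UNIV :: 'a set)"
  shows "\<exists>f :: nat \<times> 'a \<times> 'a \<times> 'a list \<Rightarrow> 'a. inj f"
proof -
  have "|UNIV \<times> UNIV :: ('a \<times> 'a) set| \<le>o |UNIV :: 'a set|"
    using card_of_Times_same_infinite[OF assms] ordIso_imp_ordLeq by blast
  then obtain p :: "'a \<times> 'a \<Rightarrow> 'a" where p: "inj p"
    using card_of_ordLeq[of "UNIV \<times> UNIV :: ('a \<times> 'a) set" "UNIV :: 'a set"] by auto
  obtain n :: "nat \<Rightarrow> 'a" where n: "inj n"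
    using infinite_countable_subset[OF assms] by blast
  define enc where "enc = rec_list (n 0) (\<lambda>x _ r. p (x, r))"
  have enc: "length xs = length ys \<Longrightarrow> enc xs = enc ys \<Longrightarrow> xs = ys" for xs ys
    by (induction xs ys rule: list_induct2) (auto simp: enc_def dest: injD[OF p])
  define f where "f = (\<lambda>(k, a, b, w). p (n k, p (a, p (b, p (n (length w), enc w)))))"
  have "inj f"
    by (rule injI) (auto simp: f_def dest!: injD[OF p] injD[OF n] enc)
  then show ?thesis by blast
qed

text \<open>Every family of partial functions indexed by \<open>'a\<close> has a forward-closed set of points of
  size at most \<open>|'a|\<close> that witnesses all inequalities and all intersections of domains.\<close>

lemma small_base:
  fixes \<theta> :: "'a \<Rightarrow> ('c \<times> 'c) set" and \<iota> :: "'a \<Rightarrow> 'b"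
  assumes inf: "infinite (UNIV :: 'a set)" and \<iota>: "inj \<iota>" and sv: "\<And>a. single_valued (\<theta> a)"
  obtains Y and g :: "'c \<Rightarrow> 'b" where
    "inj_on g Y"
    "\<And>a x y. x \<in> Y \<Longrightarrow> (x, y) \<in> \<theta> a \<Longrightarrow> y \<in> Y"
    "\<And>a b. \<theta> a \<noteq> \<theta> b \<Longrightarrow> \<exists>x\<in>Y. \<exists>y. ((x, y) \<in> \<theta> a) \<noteq> ((x, y) \<in> \<theta> b)"
    "\<And>a b. Domain (\<theta> a) \<inter> Domain (\<theta> b) \<noteq> {} \<Longrightarrow> \<exists>x\<in>Y. x \<in> Domain (\<theta> a) \<inter> Domain (\<theta> b)"
proof -
  define W :: "nat \<Rightarrow> 'a \<Rightarrow> 'a \<Rightarrow> 'c" where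
    "W k a b = (if k = 0 then SOME x. \<exists>y. ((x, y) \<in> \<theta> a) \<noteq> ((x, y) \<in> \<theta> b)
                else SOME x. x \<in> Domain (\<theta> a) \<inter> Domain (\<theta> b))" for k a b
  define run where "run = foldl (\<lambda>x a. SOME y. (x, y) \<in> \<theta> a)"
  define F where "F = (\<lambda>(k, a, b, w). run (W k a b) w)"
  define Y where "Y = range F"
  have W: "W k a b \<in> Y" for k a b
    unfolding Y_def by (rule range_eqI[of _ _ "(k, a, b, [])"]) (simp add: F_def run_def)
  obtain f :: "nat \<times> 'a \<times> 'a \<times> 'a list \<Rightarrow> 'a" where f: "inj f"
    using inj_encoding[OF inf] by blast
  show thesis
  proof
    show "inj_on (\<iota> \<circ> f \<circ> inv F) Y"
      unfolding Y_def using \<iota> f inj_on_inv_into[of "range F" F UNIV]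
      by (meson comp_inj_on inj_on_subset subset_UNIV subset_refl inj_compose)
  next
    fix a x y assume "x \<in> Y" and xy: "(x, y) \<in> \<theta> a"
    then obtain k c d w where x: "x = F (k, c, d, w)" unfolding Y_def by auto
    have "F (k, c, d, w @ [a]) = (SOME y. (x, y) \<in> \<theta> a)"
      unfolding x F_def run_def by simp
    also have "\<dots> = y"
      using xy sv[of a] by (intro some_equality) (auto dest: single_valuedD)
    finally show "y \<in> Y" unfolding Y_def by (metis rangeI)
  next
    fix a b assume "\<theta> a \<noteq> \<theta> b"
    then have "\<exists>x y. ((x, y) \<in> \<theta> a) \<noteq> ((x, y) \<in> \<theta> b)" by auto
    then have "\<exists>y. ((W 0 a b, y) \<in> \<theta> a) \<noteq> ((W 0 a b, y) \<in> \<theta> b)"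
      unfolding W_def using someI_ex[of "\<lambda>x. \<exists>y. ((x, y) \<in> \<theta> a) \<noteq> ((x, y) \<in> \<theta> b)"] by simp
    then show "\<exists>x\<in>Y. \<exists>y. ((x, y) \<in> \<theta> a) \<noteq> ((x, y) \<in> \<theta> b)" using W by blast
  next
    fix a b assume "Domain (\<theta> a) \<inter> Domain (\<theta> b) \<noteq> {}"
    then have "\<exists>x. x \<in> Domain (\<theta> a) \<inter> Domain (\<theta> b)" by blast
    then have "W 1 a b \<in> Domain (\<theta> a) \<inter> Domain (\<theta> b)"
      unfolding W_def using someI_ex[of "\<lambda>x. x \<in> Domain (\<theta> a) \<inter> Domain (\<theta> b)"] by simp
    then show "\<exists>x\<in>Y. x \<in> Domain (\<theta> a) \<inter> Domain (\<theta> b)" using W by blast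
  qed
qed

lemma sets_base_irrelevant:
  fixes A :: "'a palg" and B :: "'c set palg" and \<iota> :: "'a \<Rightarrow> 'b"
  assumes inf: "infinite (UNIV :: 'a set)" and \<iota>: "inj \<iota>"
    and \<sigma>: "abstract_sym ` \<sigma> \<subseteq> {Join, Zero}"
    and B: "palg_of_sets \<sigma> B" and iso: "palg_isomorphic (abstract_sym ` \<sigma>) A B"
  shows "\<exists>C :: 'b set palg. palg_of_sets \<sigma> C \<and> palg_isomorphic (abstract_sym ` \<sigma>) A C"
proof -
  obtain t where t: "palg_iso (abstract_sym ` \<sigma>) t A B" using iso by (auto simp: palg_isomorphic_def)
  then have tB: "pa_univ B = t ` pa_univ A" by (simp add: palg_iso_def bij_betw_def)
  have sv: "single_valued (Id_on (t a))" for a by (auto simp: single_valued_def)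
  obtain Y and g :: "'c \<Rightarrow> 'b" where g: "inj_on g Y"
    and "\<And>a x y. x \<in> Y \<Longrightarrow> (x, y) \<in> Id_on (t a) \<Longrightarrow> y \<in> Y"
    and ne: "\<And>a b. Id_on (t a) \<noteq> Id_on (t b) \<Longrightarrow>
               \<exists>x\<in>Y. \<exists>y. ((x, y) \<in> Id_on (t a)) \<noteq> ((x, y) \<in> Id_on (t b))"
    and dj: "\<And>a b. Domain (Id_on (t a)) \<inter> Domain (Id_on (t b)) \<noteq> {} \<Longrightarrow>
               \<exists>x\<in>Y. x \<in> Domain (Id_on (t a)) \<inter> Domain (Id_on (t b))"
    by (rule small_base[OF inf \<iota> sv]) (rule that)
  define h where "h X = g ` (X \<inter> Y)" for X
  define C where "C = \<lparr>pa_univ = h ` pa_univ B, pa_oper = set_oper\<rparr>"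
  have inj: "inj_on h (pa_univ B)"
  proof (rule inj_onI)
    fix X X' assume X: "X \<in> pa_univ B" "X' \<in> pa_univ B" and "h X = h X'"
    then have eq: "X \<inter> Y = X' \<inter> Y"
      unfolding h_def using g by (meson Int_lower2 inj_on_image_eq_iff)
    obtain a b where ab: "X = t a" "X' = t b" using X unfolding tB by (elim imageE)
    have "Id_on X = Id_on X'" using ne[of a b] eq ab by blast
    then show "X = X'" by (metis Domain_Id_on)
  qed
  have disj: "h X \<inter> h X' = {} \<longleftrightarrow> X \<inter> X' = {}" if X: "X \<in> pa_univ B" "X' \<in> pa_univ B" for X X'
  proof -
    obtain a b where ab: "X = t a" "X' = t b" using X unfolding tB by (elim imageE)
    have "X \<inter> X' \<noteq> {} \<Longrightarrow> \<exists>x\<in>Y. x \<in> X \<inter> X'" using dj[of a b] ab by simp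
    then show ?thesis unfolding h_def using inj_onD[OF g] by blast
  qed
  have op: "pa_oper C s (map h xs) = map_option h (pa_oper B s xs)"
    if s: "s \<in> abstract_sym ` \<sigma>" and len: "length xs = arity s" and xs: "set xs \<subseteq> pa_univ B" for s xs
  proof -
    have B': "pa_oper B = set_oper" using B by (simp add: palg_of_sets_def)
    consider "s = Zero" "xs = []" | X X' where "s = Join" "xs = [X, X']"
      using s len \<sigma> by (cases s) (auto simp: numeral_2_eq_2 length_Suc_conv)
    then show ?thesis
    proof cases
      case 1 then show ?thesis by (simp add: C_def B' h_def)
    next
      case 2
      then have X: "X \<in> pa_univ B" "X' \<in> pa_univ B" using xs by auto
      have "h (X \<union> X') = h X \<union> h X'" unfolding h_def by auto
      then show ?thesis using 2 disj[OF X]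
        by (cases "X \<inter> X' = {}") (simp_all add: C_def B')
    qed
  qed
  have uC: "pa_univ C = h ` pa_univ B" by (simp add: C_def)
  have pB: "partial_algebra (abstract_sym ` \<sigma>) B" using B by (simp add: palg_of_sets_def)
  have "palg_iso (abstract_sym ` \<sigma>) h B C" "partial_algebra (abstract_sym ` \<sigma>) C"
    using palg_iso_image[OF pB inj uC op] by auto
  then have "palg_of_sets \<sigma> C" "palg_isomorphic (abstract_sym ` \<sigma>) A C"
    using palg_iso_trans[OF t] by (auto simp: palg_of_sets_def palg_isomorphic_def C_def)
  then show ?thesis by blast
qed

lemma pfuns_base_irrelevant:
  fixes A :: "'a palg" and B :: "('c \<times> 'c) set palg" and \<iota> :: "'a \<Rightarrow> 'b"
  assumes inf: "infinite (UNIV :: 'a set)" and \<iota>: "inj \<iota>"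
    and B: "palg_of_pfuns \<sigma> B" and iso: "palg_isomorphic (abstract_sym ` \<sigma>) A B"
  shows "\<exists>C :: ('b \<times> 'b) set palg. palg_of_pfuns \<sigma> C \<and> palg_isomorphic (abstract_sym ` \<sigma>) A C"
proof -
  obtain t where t: "palg_iso (abstract_sym ` \<sigma>) t A B" using iso by (auto simp: palg_isomorphic_def)
  then have tB: "pa_univ B = t ` pa_univ A" by (simp add: palg_iso_def bij_betw_def)
  have svB: "\<And>f. f \<in> pa_univ B \<Longrightarrow> single_valued f" using B by (simp add: palg_of_pfuns_def)
  define u where "u a = (if a \<in> pa_univ A then t a else {})" for a
  have u: "u a = t a" if "a \<in> pa_univ A" for a using that by (simp add: u_def)
  have sv: "single_valued (u a)" for a using svB tB by (auto simp: u_def)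
  obtain Y and g :: "'c \<Rightarrow> 'b" where g: "inj_on g Y"
    and cl: "\<And>a x y. x \<in> Y \<Longrightarrow> (x, y) \<in> u a \<Longrightarrow> y \<in> Y"
    and ne: "\<And>a b. u a \<noteq> u b \<Longrightarrow> \<exists>x\<in>Y. \<exists>y. ((x, y) \<in> u a) \<noteq> ((x, y) \<in> u b)"
    and dj: "\<And>a b. Domain (u a) \<inter> Domain (u b) \<noteq> {} \<Longrightarrow>
               \<exists>x\<in>Y. x \<in> Domain (u a) \<inter> Domain (u b)"
    by (rule small_base[OF inf \<iota> sv]) (rule that)
  have uB: "\<exists>a. f = u a" if "f \<in> pa_univ B" for f using that u unfolding tB by force
  have cl': "y \<in> Y" if "f \<in> pa_univ B" "x \<in> Y" "(x, y) \<in> f" for f x y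
    using that cl uB by metis
  define h where "h f = {(g x, g y) | x y. (x, y) \<in> f \<and> x \<in> Y}" for f
  define C where "C = \<lparr>pa_univ = h ` pa_univ B, pa_oper = pfun_oper\<rparr>"
  have hD: "((g x, g y) \<in> h f) \<longleftrightarrow> (x, y) \<in> f" if "f \<in> pa_univ B" "x \<in> Y" "y \<in> Y" for f x y
  proof
    assume "(g x, g y) \<in> h f"
    then obtain x' y' where p: "g x = g x'" "g y = g y'" "(x', y') \<in> f" "x' \<in> Y"
      unfolding h_def by auto
    then have "x = x'" "y = y'"
      using inj_onD[OF g] that cl'[OF that(1) p(4,3)] by auto
    then show "(x, y) \<in> f" using p by simp
  next
    assume "(x, y) \<in> f"
    then show "(g x, g y) \<in> h f" unfolding h_def using that by auto
  qed
  have inj: "inj_on h (pa_univ B)"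
  proof (rule inj_onI, rule ccontr)
    fix f f' assume f: "f \<in> pa_univ B" "f' \<in> pa_univ B" and eq: "h f = h f'" and "f \<noteq> f'"
    then have "\<exists>x\<in>Y. \<exists>y. ((x, y) \<in> f) \<noteq> ((x, y) \<in> f')" using uB[OF f(1)] uB[OF f(2)] ne by blast
    then obtain x y where xy: "x \<in> Y" "((x, y) \<in> f) \<noteq> ((x, y) \<in> f')" by blast
    then have "y \<in> Y" using cl' f by blast
    then show False using xy hD[OF f(1)] hD[OF f(2)] eq by simp
  qed
  have dom: "Domain (h f) = g ` (Domain f \<inter> Y)" for f
    unfolding h_def by auto
  have disj: "Domain (h f) \<inter> Domain (h f') = {} \<longleftrightarrow> Domain f \<inter> Domain f' = {}"
    if "f \<in> pa_univ B" "f' \<in> pa_univ B" for f f'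
  proof -
    have "Domain f \<inter> Domain f' \<noteq> {} \<Longrightarrow> \<exists>x\<in>Y. x \<in> Domain f \<inter> Domain f'"
      using uB[OF that(1)] uB[OF that(2)] dj by blast
    then show ?thesis unfolding dom using inj_onD[OF g] by blast
  qed
  have comp: "h (f O f') = h f O h f'" if "f \<in> pa_univ B" "f' \<in> pa_univ B" for f f'
  proof
    show "h (f O f') \<subseteq> h f O h f'" unfolding h_def using cl'[OF that(1)] by blast
    show "h f O h f' \<subseteq> h (f O f')"
    proof
      fix p assume "p \<in> h f O h f'"
      then obtain x y y' z where "p = (g x, g z)" "(x, y) \<in> f" "x \<in> Y" "(y', z) \<in> f'" "y' \<in> Y" "g y = g y'"
        unfolding h_def by blast
      moreover have "y \<in> Y" using calculation cl'[OF that(1)] by blast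
      ultimately show "p \<in> h (f O f')" unfolding h_def using inj_onD[OF g] by blast
    qed
  qed
  have svC: "single_valued (h f)" if "f \<in> pa_univ B" for f
    unfolding single_valued_def h_def
    using inj_onD[OF g] single_valuedD[OF svB[OF that]] by blast
  have op: "pa_oper C s (map h xs) = map_option h (pa_oper B s xs)"
    if len: "length xs = arity s" and xs: "set xs \<subseteq> pa_univ B" for s xs
  proof -
    have B': "pa_oper B = pfun_oper" using B by (simp add: palg_of_pfuns_def)
    consider "s = Zero" "xs = []" | f f' where "s = Join \<or> s = Semi" "xs = [f, f']"
      using len by (cases s) (auto simp: numeral_2_eq_2 length_Suc_conv)
    then show ?thesis
    proof cases
      case 1 then show ?thesis by (simp add: C_def B' h_def)
    next
      case 2
      then have f: "f \<in> pa_univ B" "f' \<in> pa_univ B" using xs by auto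
      have "h (f \<union> f') = h f \<union> h f'" unfolding h_def by auto
      then have "pfun_oper Join [h f, h f'] = map_option h (pfun_oper Join [f, f'])"
        unfolding pfun_oper.simps disj[OF f] by simp
      then show ?thesis using 2 comp[OF f] by (auto simp: C_def B' simp del: pfun_oper.simps(1))
    qed
  qed
  have uC: "pa_univ C = h ` pa_univ B" by (simp add: C_def)
  have pB: "partial_algebra (abstract_sym ` \<sigma>) B" using B by (simp add: palg_of_pfuns_def)
  have "palg_iso (abstract_sym ` \<sigma>) h B C" "partial_algebra (abstract_sym ` \<sigma>) C"
    using palg_iso_image[OF pB inj uC op] by auto
  then have "palg_of_pfuns \<sigma> C" "palg_isomorphic (abstract_sym ` \<sigma>) A C"
    using palg_iso_trans[OF t] svC by (auto simp: palg_of_pfuns_def palg_isomorphic_def C_def)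
  then show ?thesis by blast
qed

lemma representable_base_irrelevant:
  fixes A :: "'a palg" and \<iota> :: "'a \<Rightarrow> 'b"
  assumes "infinite (UNIV :: 'a set)" and "inj \<iota>"
    and "DisjUnion \<in> \<sigma> \<Longrightarrow> Compose \<notin> \<sigma>"
    and "representable TYPE('c) \<sigma> A"
  shows "representable TYPE('b) \<sigma> A"
proof -
  have A: "partial_algebra (abstract_sym ` \<sigma>) A"
    using assms(4) by (simp add: representable_def)
  from assms(4) consider
      B :: "'c set palg" where "DisjUnion \<in> \<sigma>" "palg_of_sets \<sigma> B"
        "palg_isomorphic (abstract_sym ` \<sigma>) A B"
    | B :: "('c \<times> 'c) set palg" where "DomDisjUnion \<in> \<sigma>" "palg_of_pfuns \<sigma> B"
        "palg_isomorphic (abstract_sym ` \<sigma>) A B"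
    unfolding representable_def by blast
  then show ?thesis
  proof cases
    case (1 B)
    have "abstract_sym ` \<sigma> \<subseteq> {Join, Zero}"
    proof
      fix s assume "s \<in> abstract_sym ` \<sigma>"
      then obtain c where "c \<in> \<sigma>" "s = abstract_sym c" by blast
      then show "s \<in> {Join, Zero}" using assms(3)[OF 1(1)] by (cases c) auto
    qed
    from sets_base_irrelevant[OF assms(1,2) this 1(2,3)] show ?thesis
      unfolding representable_def using A 1(1) by (intro conjI disjI1)
  next
    case (2 B)
    from pfuns_base_irrelevant[OF assms(1,2) 2(2,3)] show ?thesis
      unfolding representable_def using A 2(1) by (intro conjI disjI2)
  qed
qed

section \<open>First-order logic with equality over J, composition and 0\<close>

text \<open>For a set \<open>S\<close> of abstract symbols containing \<open>Join\<close>, the language \<open>\<L>(S)\<close> has the ternary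
  relation symbol \<open>J\<close>, the binary function symbol \<open>;\<close> if \<open>Semi \<in> S\<close>, and the constant symbol \<open>0\<close>
  if \<open>Zero \<in> S\<close>.\<close>

datatype fo_term = Var nat | CZero | FSemi fo_term fo_term

datatype fo_form =
    Eq fo_term fo_term
  | J fo_term fo_term fo_term
  | Neg fo_form
  | Conj fo_form fo_form
  | Forall nat fo_form

fun term_vars :: "fo_term \<Rightarrow> nat set" where
  "term_vars (Var n) = {n}"
| "term_vars CZero = {}"
| "term_vars (FSemi t u) = term_vars t \<union> term_vars u"

fun free_vars :: "fo_form \<Rightarrow> nat set" where
  "free_vars (Eq t u) = term_vars t \<union> term_vars u"
| "free_vars (J t u v) = term_vars t \<union> term_vars u \<union> term_vars v"
| "free_vars (Neg \<phi>) = free_vars \<phi>"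
| "free_vars (Conj \<phi> \<psi>) = free_vars \<phi> \<union> free_vars \<psi>"
| "free_vars (Forall n \<phi>) = free_vars \<phi> - {n}"

fun term_in :: "abs_sym set \<Rightarrow> fo_term \<Rightarrow> bool" where
  "term_in S (Var n) \<longleftrightarrow> True"
| "term_in S CZero \<longleftrightarrow> Zero \<in> S"
| "term_in S (FSemi t u) \<longleftrightarrow> Semi \<in> S \<and> term_in S t \<and> term_in S u"

fun form_in :: "abs_sym set \<Rightarrow> fo_form \<Rightarrow> bool" where
  "form_in S (Eq t u) \<longleftrightarrow> term_in S t \<and> term_in S u"
| "form_in S (J t u v) \<longleftrightarrow> Join \<in> S \<and> term_in S t \<and> term_in S u \<and> term_in S v"
| "form_in S (Neg \<phi>) \<longleftrightarrow> form_in S \<phi>"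
| "form_in S (Conj \<phi> \<psi>) \<longleftrightarrow> form_in S \<phi> \<and> form_in S \<psi>"
| "form_in S (Forall n \<phi>) \<longleftrightarrow> form_in S \<phi>"

definition sentence :: "abs_sym set \<Rightarrow> fo_form \<Rightarrow> bool" where
  "sentence S \<phi> \<longleftrightarrow> form_in S \<phi> \<and> free_vars \<phi> = {}"

record 'a fo_struct =
  fo_univ :: "'a set"
  fo_J :: "'a \<Rightarrow> 'a \<Rightarrow> 'a \<Rightarrow> bool"
  fo_semi :: "'a \<Rightarrow> 'a \<Rightarrow> 'a"
  fo_zero :: 'a

text \<open>The interpretations of function symbols outside \<open>S\<close> are junk.\<close>

definition fo_structure :: "abs_sym set \<Rightarrow> 'a fo_struct \<Rightarrow> bool" where
  "fo_structure S M \<longleftrightarrow>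
     (Semi \<in> S \<longrightarrow> (\<forall>a\<in>fo_univ M. \<forall>b\<in>fo_univ M. fo_semi M a b \<in> fo_univ M)) \<and>
     (Zero \<in> S \<longrightarrow> fo_zero M \<in> fo_univ M)"

fun term_val :: "'a fo_struct \<Rightarrow> (nat \<Rightarrow> 'a) \<Rightarrow> fo_term \<Rightarrow> 'a" where
  "term_val M e (Var n) = e n"
| "term_val M e CZero = fo_zero M"
| "term_val M e (FSemi t u) = fo_semi M (term_val M e t) (term_val M e u)"

fun sat :: "'a fo_struct \<Rightarrow> (nat \<Rightarrow> 'a) \<Rightarrow> fo_form \<Rightarrow> bool" where
  "sat M e (Eq t u) \<longleftrightarrow> term_val M e t = term_val M e u"
| "sat M e (J t u v) \<longleftrightarrow> fo_J M (term_val M e t) (term_val M e u) (term_val M e v)"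
| "sat M e (Neg \<phi>) \<longleftrightarrow> \<not> sat M e \<phi>"
| "sat M e (Conj \<phi> \<psi>) \<longleftrightarrow> sat M e \<phi> \<and> sat M e \<psi>"
| "sat M e (Forall n \<phi>) \<longleftrightarrow> (\<forall>a\<in>fo_univ M. sat M (e(n := a)) \<phi>)"

text \<open>The assignment in \<open>models\<close> is not required to take its values in the universe: the
  truth value of a sentence does not depend on it, and the universe may be empty.\<close>

definition models :: "'a fo_struct \<Rightarrow> fo_form \<Rightarrow> bool" where
  "models M \<phi> \<longleftrightarrow> (\<forall>e. sat M e \<phi>)"

lemma term_val_cong:
  "(\<And>n. n \<in> term_vars t \<Longrightarrow> e n = e' n) \<Longrightarrow> term_val M e t = term_val M e' t"
  by (induction t) auto

lemma sat_cong:
  "(\<And>n. n \<in> free_vars \<phi> \<Longrightarrow> e n = e' n) \<Longrightarrow> sat M e \<phi> \<longleftrightarrow> sat M e' \<phi>"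
proof (induction \<phi> arbitrary: e e')
  case (Eq t u)
  then show ?case using term_val_cong[of t e e' M] term_val_cong[of u e e' M] by simp
next
  case (J t u v)
  then show ?case
    using term_val_cong[of t e e' M] term_val_cong[of u e e' M] term_val_cong[of v e e' M] by simp
next
  case (Neg \<phi>)
  then have "sat M e \<phi> = sat M e' \<phi>" by (intro Neg.IH) auto
  then show ?case by simp
next
  case (Conj \<phi> \<psi>)
  have "sat M e \<phi> = sat M e' \<phi>" by (rule Conj.IH(1)) (use Conj.prems in auto)
  moreover have "sat M e \<psi> = sat M e' \<psi>" by (rule Conj.IH(2)) (use Conj.prems in auto)
  ultimately show ?case by simp
next
  case (Forall n \<phi>)
  have "sat M (e(n := a)) \<phi> = sat M (e'(n := a)) \<phi>" for a
    by (rule Forall.IH) (use Forall.prems in auto)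
  then show ?case by simp
qed

lemma models_sentence: "sentence S \<phi> \<Longrightarrow> models M \<phi> \<longleftrightarrow> sat M e \<phi>"
  unfolding models_def sentence_def using sat_cong[of \<phi> _ e M] by (metis empty_iff)

section \<open>Axiomatisability\<close>

text \<open>\<open>structure_of S A M\<close>: the \<open>\<L>(S)\<close>-structure \<open>M\<close> is the partial algebra \<open>A\<close> viewed in the
  language \<open>\<L>(S)\<close>.  As \<open>;\<close> and \<open>0\<close> are function symbols, such an \<open>M\<close> exists only if the
  corresponding operations of \<open>A\<close> are total, which is so in every representable \<open>A\<close>.\<close>

definition structure_of :: "abs_sym set \<Rightarrow> 'a palg \<Rightarrow> 'a fo_struct \<Rightarrow> bool" where
  "structure_of S A M \<longleftrightarrow>
     fo_univ M = pa_univ A \<and>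
     (Join \<in> S \<longrightarrow> (\<forall>a\<in>pa_univ A. \<forall>b\<in>pa_univ A. \<forall>c\<in>pa_univ A.
        fo_J M a b c \<longleftrightarrow> pa_oper A Join [a, b] = Some c)) \<and>
     (Semi \<in> S \<longrightarrow> (\<forall>a\<in>pa_univ A. \<forall>b\<in>pa_univ A. pa_oper A Semi [a, b] = Some (fo_semi M a b))) \<and>
     (Zero \<in> S \<longrightarrow> pa_oper A Zero [] = Some (fo_zero M))"

definition representable_struct :: "'b itself \<Rightarrow> conc_sym set \<Rightarrow> 'a fo_struct \<Rightarrow> bool" where
  "representable_struct T \<sigma> M \<longleftrightarrow>
     (\<exists>A. representable T \<sigma> A \<and> structure_of (abstract_sym ` \<sigma>) A M)"

text \<open>\<open>K\<close> is a class of structures with universes contained in the type \<open>'a\<close>.  Any sentences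
  axiomatising a class of structures of all sizes axiomatise its restriction to \<open>'a\<close>, so failure
  of finite axiomatisability over some \<open>'a\<close> implies its failure outright.\<close>

definition finitely_axiomatisable :: "abs_sym set \<Rightarrow> ('a fo_struct \<Rightarrow> bool) \<Rightarrow> bool" where
  "finitely_axiomatisable S K \<longleftrightarrow>
     (\<exists>\<Phi>. finite \<Phi> \<and> (\<forall>\<phi>\<in>\<Phi>. sentence S \<phi>) \<and>
        (\<forall>M. fo_structure S M \<longrightarrow> ((\<forall>\<phi>\<in>\<Phi>. models M \<phi>) \<longleftrightarrow> K M)))"

end

theory Submission
  imports Defs
begin

text \<open>In the grid algebra with \<open>m\<close> rows and \<open>n\<close> columns the elements are the subsets of rows, the
  proper subsets of columns and the whole grid, joined by disjoint union, except that a full column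
  is identified with the whole grid.  A point in the representation of the whole grid selects
  exactly one cell of each column and at most one cell of each row, hence an injection from columns
  to rows.  So \<open>n \<le> m\<close> is necessary for representability, and for \<open>m \<ge> n + 3\<close> sending an
  element to the set of injections that meet it is a representation.  Every element is a rectangle,
  so a position of an Ehrenfeucht--Fraisse game is recorded by colourings of the rows and of the
  columns, and a sentence of bounded quantifier rank cannot compare two large numbers \<open>m\<close> and \<open>n\<close>.
  With the empty set as \<open>0\<close> and \<open>a ; b = 0\<close> for all \<open>a\<close>, \<open>b\<close>, the same algebras serve all six
  signatures.\<close>

section \<open>Back-and-forth systems\<close>

fun qrank :: "fo_form \<Rightarrow> nat" where
  "qrank (Eq t u) = 0"
| "qrank (J t u v) = 0"
| "qrank (Neg \<phi>) = qrank \<phi>"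
| "qrank (Conj \<phi> \<psi>) = max (qrank \<phi>) (qrank \<psi>)"
| "qrank (Forall n \<phi>) = Suc (qrank \<phi>)"

text \<open>A position \<open>p\<close> is a relation that may hold many pairs at once, and
  \<open>Z k p\<close> says that it survives \<open>k\<close> more rounds. As \<open>p\<close>
  respects the function symbols, the values of every term stay related, so nested terms cost no
  rounds and only quantifiers are counted.\<close>

lemma back_and_forth:
  fixes M :: "'a fo_struct" and M' :: "'b fo_struct" and Z :: "nat \<Rightarrow> ('a \<Rightarrow> 'b \<Rightarrow> bool) \<Rightarrow> bool"
  assumes zero: "\<And>k p. Z k p \<Longrightarrow> p (fo_zero M) (fo_zero M')"
    and semi: "\<And>k p a a' b b'. Z k p \<Longrightarrow> p a a' \<Longrightarrow> p b b' \<Longrightarrow> p (fo_semi M a b) (fo_semi M' a' b')"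
    and eq: "\<And>k p a a' b b'. Z k p \<Longrightarrow> p a a' \<Longrightarrow> p b b' \<Longrightarrow> a = b \<longleftrightarrow> a' = b'"
    and J: "\<And>k p a a' b b' c c'. Z k p \<Longrightarrow> p a a' \<Longrightarrow> p b b' \<Longrightarrow> p c c' \<Longrightarrow> fo_J M a b c \<longleftrightarrow> fo_J M' a' b' c'"
    and zig: "\<And>k p a. Z (Suc k) p \<Longrightarrow> a \<in> fo_univ M \<Longrightarrow> \<exists>a'\<in>fo_univ M'. \<exists>q. Z k q \<and> p \<le> q \<and> q a a'"
    and zag: "\<And>k p a'. Z (Suc k) p \<Longrightarrow> a' \<in> fo_univ M' \<Longrightarrow> \<exists>a\<in>fo_univ M. \<exists>q. Z k q \<and> p \<le> q \<and> q a a'"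
    and "Z k p" "qrank \<phi> \<le> k" "\<And>v. p (e v) (e' v)"
  shows "sat M e \<phi> \<longleftrightarrow> sat M' e' \<phi>"
  using assms(7-)
proof (induction \<phi> arbitrary: k p e e')
  case (Eq t u)
  have tv: "p (term_val M e t) (term_val M' e' t)" for t
    by (induction t) (auto intro: Eq.prems(3) zero[OF Eq.prems(1)] semi[OF Eq.prems(1)])
  show ?case using eq[OF Eq(1) tv tv] by simp
next
  case (J t u v)
  have tv: "p (term_val M e t) (term_val M' e' t)" for t
    by (induction t) (auto intro: J.prems(3) zero[OF J.prems(1)] semi[OF J.prems(1)])
  show ?case using assms(4)[OF J(1) tv tv tv] by simp
next
  case (Neg \<phi>)
  then show ?case using Neg.IH[OF Neg.prems(1) _ Neg.prems(3)] by simp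
next
  case (Conj \<phi> \<psi>)
  have "sat M e \<phi> = sat M' e' \<phi>"
    by (rule Conj.IH(1)[OF Conj.prems(1)]) (use Conj.prems in auto)
  moreover have "sat M e \<psi> = sat M' e' \<psi>"
    by (rule Conj.IH(2)[OF Conj.prems(1)]) (use Conj.prems in auto)
  ultimately show ?case by simp
next
  case (Forall n \<phi>)
  then obtain k' where k: "k = Suc k'" "qrank \<phi> \<le> k'" by (cases k) auto
  have ext: "sat M (e(n := a)) \<phi> \<longleftrightarrow> sat M' (e'(n := a')) \<phi>" if "Z k' q" "p \<le> q" "q a a'" for a a' q
    by (rule Forall.IH[OF that(1) k(2)]) (use that Forall.prems(3) in auto)
  show ?case
  proof
    assume sat: "sat M e (Forall n \<phi>)"
    show "sat M' e' (Forall n \<phi>)"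
      unfolding sat.simps
    proof
      fix a' assume "a' \<in> fo_univ M'"
      then obtain a q where "a \<in> fo_univ M" "Z k' q" "p \<le> q" "q a a'"
        using zag[of k' p a'] Forall.prems(1) k(1) by blast
      then show "sat M' (e'(n := a')) \<phi>" using ext sat by auto
    qed
  next
    assume sat: "sat M' e' (Forall n \<phi>)"
    show "sat M e (Forall n \<phi>)"
      unfolding sat.simps
    proof
      fix a assume "a \<in> fo_univ M"
      then obtain a' q where "a' \<in> fo_univ M'" "Z k' q" "p \<le> q" "q a a'"
        using zig[of k' p a] Forall.prems(1) k(1) by blast
      then show "sat M (e(n := a)) \<phi>" using ext sat by auto
    qed
  qed
qed

section \<open>Colourings with the same counts up to a threshold\<close>

text \<open>In the game a colour is the list of membership bits in the sets chosen so far, so the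
  colour classes are the cells these sets cut out. Class sizes of \<open>N\<close> and more are not
  told apart.\<close>

definition similar :: "nat \<Rightarrow> 'x set \<Rightarrow> 'y set \<Rightarrow> ('x \<Rightarrow> 'c) \<Rightarrow> ('y \<Rightarrow> 'c) \<Rightarrow> bool" where
  "similar N X Y \<rho> \<rho>' \<longleftrightarrow>
     (\<forall>c. min N (card {x\<in>X. \<rho> x = c}) = min N (card {y\<in>Y. \<rho>' y = c}))"

lemma similar_sym: "similar N X Y \<rho> \<rho>' \<Longrightarrow> similar N Y X \<rho>' \<rho>"
  by (simp add: similar_def)

lemma similar_partner:
  assumes "similar N X Y \<rho> \<rho>'" "finite X" "0 < N" "x \<in> X"
  shows "\<exists>y\<in>Y. \<rho>' y = \<rho> x"
proof -
  have "card {z\<in>X. \<rho> z = \<rho> x} \<noteq> 0" using assms by auto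
  moreover have "min N (card {z\<in>X. \<rho> z = \<rho> x}) = min N (card {y\<in>Y. \<rho>' y = \<rho> x})"
    using assms(1) unfolding similar_def by (rule spec)
  ultimately have "card {y\<in>Y. \<rho>' y = \<rho> x} \<noteq> 0" using assms(3) by linarith
  then have "{y\<in>Y. \<rho>' y = \<rho> x} \<noteq> {}" by (metis card.empty)
  then show ?thesis by blast
qed

text \<open>A threshold of at least 2 tells size 1 from size 0 and from all larger sizes.\<close>

lemma similar_singleton:
  assumes "similar N X Y \<rho> \<rho>'" "2 \<le> N" "{x\<in>X. \<rho> x = c} = {x0}"
  obtains y0 where "{y\<in>Y. \<rho>' y = c} = {y0}"
proof -
  have "min N (card {x\<in>X. \<rho> x = c}) = min N (card {y\<in>Y. \<rho>' y = c})"
    using assms(1) unfolding similar_def by (rule spec)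
  moreover have "card {x\<in>X. \<rho> x = c} = 1" using assms(3) by simp
  ultimately have "card {y\<in>Y. \<rho>' y = c} = 1" using assms(2) by linarith
  then show thesis using that card_1_singletonE by blast
qed

text \<open>If \<open>a\<close> and \<open>b\<close> differ, both are at least \<open>2 * N\<close>,
  so at most one of \<open>s\<close> and \<open>a - s\<close> is below \<open>N\<close>. A small
  part is copied exactly, which leaves at least \<open>N\<close> on the other side. If both parts
  are large, \<open>t = N\<close> leaves at least \<open>N\<close> as well.\<close>

lemma split_threshold:
  fixes a b s N :: nat
  assumes "min (2 * N) a = min (2 * N) b" "s \<le> a"
  shows "\<exists>t\<le>b. min N s = min N t \<and> min N (a - s) = min N (b - t)"
proof -
  consider "a = b" | "2 * N \<le> a" "2 * N \<le> b" using assms(1) by linarith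
  then show ?thesis
  proof cases
    case 1 then show ?thesis using assms(2) by auto
  next
    case 2
    consider "s < N" | "a - s < N" | "N \<le> s" "N \<le> a - s" by linarith
    then show ?thesis
    proof cases
      case 1 then show ?thesis using 2 by (intro exI[of _ s]) auto
    next
      case a: 2 then show ?thesis using 2 assms(2) by (intro exI[of _ "b - (a - s)"]) auto
    next
      case 3 then show ?thesis using 2 by (intro exI[of _ N]) auto
    qed
  qed
qed

text \<open>Each colour class is split separately by \<open>split_threshold\<close>. This halves the
  threshold, which is the price of one round.\<close>

lemma similar_refine:
  assumes sim: "similar (2 * N) X Y \<rho> \<rho>'" and fin: "finite X" "finite Y" and S: "S \<subseteq> X"
  obtains T where "T \<subseteq> Y" "similar N X Y (\<lambda>x. (x \<in> S) # \<rho> x) (\<lambda>y. (y \<in> T) # \<rho>' y)"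
proof -
  have "\<exists>T\<subseteq>{y\<in>Y. \<rho>' y = c}. min N (card {x\<in>S. \<rho> x = c}) = min N (card T) \<and>
          min N (card {x\<in>X - S. \<rho> x = c}) = min N (card ({y\<in>Y. \<rho>' y = c} - T))" for c
  proof -
    let ?A = "{x\<in>X. \<rho> x = c}" and ?B = "{y\<in>Y. \<rho>' y = c}" and ?S = "{x\<in>S. \<rho> x = c}"
    have fS: "finite ?S" using finite_subset[OF S fin(1)] by simp
    have sub: "?S \<subseteq> ?A" using S by auto
    have "card ?S \<le> card ?A" using sub fin by (simp add: card_mono)
    then obtain t where t: "t \<le> card ?B" "min N (card ?S) = min N t"
        "min N (card ?A - card ?S) = min N (card ?B - t)"
      using split_threshold[of N "card ?A" "card ?B" "card ?S"] sim unfolding similar_def by auto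
    obtain T where T: "T \<subseteq> ?B" "card T = t" "finite T"
      using obtain_subset_with_card_n[OF t(1)] by blast
    have "{x\<in>X - S. \<rho> x = c} = ?A - ?S" by auto
    then have "card {x\<in>X - S. \<rho> x = c} = card ?A - card ?S"
      using card_Diff_subset[OF fS sub] by simp
    moreover have "card (?B - T) = card ?B - t" using card_Diff_subset[OF T(3,1)] T(2) by simp
    ultimately show ?thesis using T t by (intro exI[of _ T]) auto
  qed
  then have "\<forall>c. \<exists>T. T \<subseteq> {y\<in>Y. \<rho>' y = c} \<and>
      min N (card {x\<in>S. \<rho> x = c}) = min N (card T) \<and>
      min N (card {x\<in>X - S. \<rho> x = c}) = min N (card ({y\<in>Y. \<rho>' y = c} - T))" by (rule allI)
  from choice[OF this] obtain T where "\<forall>c. T c \<subseteq> {y\<in>Y. \<rho>' y = c} \<and>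
      min N (card {x\<in>S. \<rho> x = c}) = min N (card (T c)) \<and>
      min N (card {x\<in>X - S. \<rho> x = c}) = min N (card ({y\<in>Y. \<rho>' y = c} - T c))" by (elim exE)
  note T = this[rule_format, THEN conjunct1] this[rule_format, THEN conjunct2, THEN conjunct1]
    this[rule_format, THEN conjunct2, THEN conjunct2]
  \<comment> \<open>The sets \<open>T c\<close> lie in distinct colour classes, so their union meets
    the class of \<open>c\<close> in exactly \<open>T c\<close>.\<close>
  define U where "U = (\<Union>c. T c)"
  have U: "U \<subseteq> Y" "\<And>c. {y\<in>U. \<rho>' y = c} = T c" "\<And>c. {y\<in>Y - U. \<rho>' y = c} = {y\<in>Y. \<rho>' y = c} - T c"
    unfolding U_def using T(1) by blast+
  have "similar N X Y (\<lambda>x. (x \<in> S) # \<rho> x) (\<lambda>y. (y \<in> U) # \<rho>' y)"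
    unfolding similar_def
  proof
    fix l :: "bool list"
    consider "l = []" | c where "l = True # c" | c where "l = False # c" by (cases l) auto
    then show "min N (card {x\<in>X. (x \<in> S) # \<rho> x = l}) = min N (card {y\<in>Y. (y \<in> U) # \<rho>' y = l})"
    proof cases
      case 1 then show ?thesis by simp
    next
      case (2 c)
      have "{x\<in>X. (x \<in> S) # \<rho> x = l} = {x\<in>S. \<rho> x = c}" "{y\<in>Y. (y \<in> U) # \<rho>' y = l} = T c"
        using 2 S U(1) U(2)[of c] by auto
      then show ?thesis using T(2) by simp
    next
      case (3 c)
      have "{x\<in>X. (x \<in> S) # \<rho> x = l} = {x\<in>X - S. \<rho> x = c}"
        "{y\<in>Y. (y \<in> U) # \<rho>' y = l} = {y\<in>Y. \<rho>' y = c} - T c"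
        using 3 U(3)[of c] by auto
      then show ?thesis using T(3) by simp
    qed
  qed
  then show thesis using that U(1) by blast
qed

section \<open>Singletons and full sets under refinement\<close>

text \<open>If \<open>S = {s}\<close>, the refined colour of \<open>s\<close> belongs to
  \<open>s\<close> alone, hence to a single \<open>t\<close> in \<open>Y\<close>. Every member of
  \<open>T\<close> has a partner whose colour also starts with \<open>True\<close>; that partner is
  \<open>s\<close>, so the member is \<open>t\<close>.\<close>

lemma refine_card_1:
  assumes sim: "similar N X Y (\<lambda>x. (x \<in> S) # \<rho> x) (\<lambda>y. (y \<in> T) # \<rho>' y)"
    and fin: "finite Y" and N: "2 \<le> N" and ST: "S \<subseteq> X" "T \<subseteq> Y" and S: "card S = 1"
  shows "card T = 1"
proof -
  obtain s where s: "S = {s}" using S card_1_singletonE by blast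
  have "{x\<in>X. (x \<in> S) # \<rho> x = True # \<rho> s} = {s}" using s ST by auto
  then obtain t where t: "{y\<in>Y. (y \<in> T) # \<rho>' y = True # \<rho> s} = {t}"
    by (rule similar_singleton[OF sim N])
  have "y \<in> T \<longleftrightarrow> y = t" for y
  proof
    assume y: "y \<in> T"
    then have "y \<in> Y" using ST by auto
    then obtain x where "(x \<in> S) # \<rho> x = (y \<in> T) # \<rho>' y"
      using similar_partner[OF similar_sym[OF sim] fin _ \<open>y \<in> Y\<close>] N by auto
    then have "(y \<in> T) # \<rho>' y = True # \<rho> s" using y s by auto
    then show "y = t" using t \<open>y \<in> Y\<close> by blast
  next
    assume "y = t" then show "y \<in> T" using t by auto
  qed
  then have "T = {t}" by blast
  then show ?thesis by simp
qed

text \<open>A chosen set is full when no refined colour starting with \<open>False\<close> occurs,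
  and similar colourings realise the same colours.\<close>

lemma refine_full:
  assumes sim: "similar N X Y (\<lambda>x. (x \<in> S) # \<rho> x) (\<lambda>y. (y \<in> T) # \<rho>' y)"
    and fin: "finite X" "finite Y" and N: "2 \<le> N" and ST: "S \<subseteq> X" "T \<subseteq> Y"
  shows "S = X \<longleftrightarrow> T = Y"
proof -
  have N': "0 < N" using N by simp
  have "x \<in> T" if "S = X" "x \<in> Y" for x
    using similar_partner[OF similar_sym[OF sim] fin(2) N' that(2)] that(1) by auto
  moreover have "x \<in> S" if "T = Y" "x \<in> X" for x
    using similar_partner[OF sim fin(1) N' that(2)] that(1) by auto
  ultimately show ?thesis using ST by blast
qed

section \<open>Grid algebras\<close>

definition elems :: "nat \<Rightarrow> nat \<Rightarrow> (nat \<times> nat) set set" where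
  "elems m n = {X \<times> Y | X Y. X \<subseteq> {..<m} \<and> Y \<subseteq> {..<n} \<and>
     (card X = 1 \<or> card Y = 1 \<and> X \<noteq> {..<m} \<or> X = {..<m} \<and> Y = {..<n})}"

text \<open>The second alternative for \<open>c\<close> carries the identification: two disjoint
  pieces that fill a column join to the whole grid.\<close>

definition join :: "nat \<Rightarrow> nat \<Rightarrow> (nat \<times> nat) set \<Rightarrow> (nat \<times> nat) set \<Rightarrow> (nat \<times> nat) set \<Rightarrow> bool" where
  "join m n a b c \<longleftrightarrow> a \<inter> b = {} \<and>
     (c = a \<union> b \<or> (\<exists>j<n. a \<union> b = {..<m} \<times> {j}) \<and> c = {..<m} \<times> {..<n})"

lemma elems_subset: "a \<in> elems m n \<Longrightarrow> a \<subseteq> {..<m} \<times> {..<n}"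
  by (auto simp: elems_def)

lemma finite_elems: "finite (elems m n)"
  by (rule finite_subset[of _ "Pow ({..<m} \<times> {..<n})"]) (use elems_subset in auto)

lemma empty_elem: "0 < m \<Longrightarrow> {} \<in> elems m n"
  unfolding elems_def by (rule CollectI, rule exI[of _ "{0}"], rule exI[of _ "{}"]) auto

lemma grid_elem: "{..<m} \<times> {..<n} \<in> elems m n"
  unfolding elems_def by blast

lemma row_elem: "i < m \<Longrightarrow> Y \<subseteq> {..<n} \<Longrightarrow> {i} \<times> Y \<in> elems m n"
  unfolding elems_def by (rule CollectI, rule exI[of _ "{i}"], rule exI[of _ Y]) auto

lemma column_elem: "j < n \<Longrightarrow> X \<subseteq> {..<m} \<Longrightarrow> X \<noteq> {..<m} \<Longrightarrow> X \<times> {j} \<in> elems m n"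
  unfolding elems_def by (rule CollectI, rule exI[of _ X], rule exI[of _ "{j}"]) auto

lemma elems_cases:
  assumes "a \<in> elems m n"
  obtains (row) i Y where "i < m" "Y \<subseteq> {..<n}" "a = {i} \<times> Y"
  | (column) j X where "j < n" "X \<subset> {..<m}" "a = X \<times> {j}"
  | (grid) "a = {..<m} \<times> {..<n}"
proof -
  obtain X Y where XY: "a = X \<times> Y" "X \<subseteq> {..<m}" "Y \<subseteq> {..<n}"
    "card X = 1 \<or> card Y = 1 \<and> X \<noteq> {..<m} \<or> X = {..<m} \<and> Y = {..<n}"
    using assms unfolding elems_def by blast
  from XY(4) show thesis
  proof (elim disjE conjE)
    assume "card X = 1"
    then obtain i where "X = {i}" using card_1_singletonE by blast
    then show thesis using row[of i Y] XY by auto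
  next
    assume "card Y = 1" "X \<noteq> {..<m}"
    then obtain j where "Y = {j}" using card_1_singletonE by blast
    then show thesis using column[of j X] XY \<open>X \<noteq> {..<m}\<close> by auto
  next
    assume "X = {..<m}" "Y = {..<n}"
    then show thesis using grid XY by auto
  qed
qed

section \<open>Back-and-forth between grid algebras\<close>

text \<open>Call the cells with a given row colour and a given column colour a block. When the
  colourings are similar with a positive threshold, related sets are unions of blocks with the same
  pairs of colours.\<close>

definition corr :: "nat \<Rightarrow> nat \<Rightarrow> nat \<Rightarrow> nat \<Rightarrow> (nat \<Rightarrow> 'c) \<Rightarrow> (nat \<Rightarrow> 'd) \<Rightarrow> (nat \<Rightarrow> 'c) \<Rightarrow> (nat \<Rightarrow> 'd) \<Rightarrow>
    (nat \<times> nat) set \<Rightarrow> (nat \<times> nat) set \<Rightarrow> bool" where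
  "corr m n m' n' \<rho> \<gamma> \<rho>' \<gamma>' a a' \<longleftrightarrow> a \<subseteq> {..<m} \<times> {..<n} \<and> a' \<subseteq> {..<m'} \<times> {..<n'} \<and>
     (\<forall>x<m. \<forall>y<n. \<forall>x'<m'. \<forall>y'<n'. \<rho> x = \<rho>' x' \<longrightarrow> \<gamma> y = \<gamma>' y' \<longrightarrow> ((x, y) \<in> a \<longleftrightarrow> (x', y') \<in> a'))"

lemma corr_sym: "corr m n m' n' \<rho> \<gamma> \<rho>' \<gamma>' a a' \<Longrightarrow> corr m' n' m n \<rho>' \<gamma>' \<rho> \<gamma> a' a"
  unfolding corr_def by metis

lemma corr_empty: "corr m n m' n' \<rho> \<gamma> \<rho>' \<gamma>' {} {}"
  by (simp add: corr_def)

lemma corr_grid: "corr m n m' n' \<rho> \<gamma> \<rho>' \<gamma>' ({..<m} \<times> {..<n}) ({..<m'} \<times> {..<n'})"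
  by (simp add: corr_def)

lemma corr_Un:
  "corr m n m' n' \<rho> \<gamma> \<rho>' \<gamma>' a a' \<Longrightarrow> corr m n m' n' \<rho> \<gamma> \<rho>' \<gamma>' b b' \<Longrightarrow>
   corr m n m' n' \<rho> \<gamma> \<rho>' \<gamma>' (a \<union> b) (a' \<union> b')"
  unfolding corr_def by (intro conjI) (blast, blast, simp)

lemma corr_Int:
  "corr m n m' n' \<rho> \<gamma> \<rho>' \<gamma>' a a' \<Longrightarrow> corr m n m' n' \<rho> \<gamma> \<rho>' \<gamma>' b b' \<Longrightarrow>
   corr m n m' n' \<rho> \<gamma> \<rho>' \<gamma>' (a \<inter> b) (a' \<inter> b')"
  unfolding corr_def by (intro conjI) (blast, blast, simp)

lemma corr_iff:
  assumes "corr m n m' n' \<rho> \<gamma> \<rho>' \<gamma>' a a'" "x < m" "y < n" "x' < m'" "y' < n'" "\<rho> x = \<rho>' x'" "\<gamma> y = \<gamma>' y'"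
  shows "(x, y) \<in> a \<longleftrightarrow> (x', y') \<in> a'"
  using assms unfolding corr_def by blast

section \<open>Related sets satisfy the same atomic formulas\<close>

lemma corr_eq:
  assumes r: "similar N {..<m} {..<m'} \<rho> \<rho>'" and c: "similar N {..<n} {..<n'} \<gamma> \<gamma>'" and N: "2 \<le> N"
    and a: "corr m n m' n' \<rho> \<gamma> \<rho>' \<gamma>' a a'" and b: "corr m n m' n' \<rho> \<gamma> \<rho>' \<gamma>' b b'"
  shows "a = b \<longleftrightarrow> a' = b'"
proof -
  \<comment> \<open>Each cell of the second grid has a partner of the same colours in the first,
    where \<open>a\<close> alone decides membership in \<open>a'\<close> and in \<open>b'\<close>.
    The parameters are fixed afresh so that the grids can also be exchanged.\<close>
  have aux: "a' \<subseteq> b'" if r: "similar N {..<m} {..<m'} \<rho> \<rho>'" and c: "similar N {..<n} {..<n'} \<gamma> \<gamma>'"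
    and a: "corr m n m' n' \<rho> \<gamma> \<rho>' \<gamma>' a a'" and b: "corr m n m' n' \<rho> \<gamma> \<rho>' \<gamma>' a b'"
    for m n m' n' \<rho> \<rho>' \<gamma> \<gamma>' a a' b'
  proof
    fix z assume z: "z \<in> a'"
    then obtain x' y' where x': "z = (x', y')" "x' < m'" "y' < n'" using a unfolding corr_def by blast
    obtain x where x: "x < m" "\<rho> x = \<rho>' x'"
      using similar_partner[OF similar_sym[OF r] finite_lessThan, of x'] x' N by auto
    obtain y where y: "y < n" "\<gamma> y = \<gamma>' y'"
      using similar_partner[OF similar_sym[OF c] finite_lessThan, of y'] x' N by auto
    show "z \<in> b'" using corr_iff[OF a x(1) y(1) x'(2,3) x(2) y(2)]
        corr_iff[OF b x(1) y(1) x'(2,3) x(2) y(2)] z x'(1) by simp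
  qed
  show ?thesis
    using aux[OF r c a] aux[OF r c b] aux[OF similar_sym[OF r] similar_sym[OF c] corr_sym[OF a]]
      aux[OF similar_sym[OF r] similar_sym[OF c] corr_sym[OF b]] a b corr_sym[OF a] corr_sym[OF b]
    by blast
qed

text \<open>The column \<open>j\<close> must be the only one of its colour, since cells of equal
  colours are all inside or all outside \<open>a\<close>. A colour used once is used once in the
  other grid too, which gives \<open>j'\<close>.\<close>

lemma corr_full_column:
  assumes r: "similar N {..<m} {..<m'} \<rho> \<rho>'" and c: "similar N {..<n} {..<n'} \<gamma> \<gamma>'" and N: "2 \<le> N"
    and a: "corr m n m' n' \<rho> \<gamma> \<rho>' \<gamma>' a a'" and m: "0 < m" and j: "j < n" "a = {..<m} \<times> {j}"
  shows "\<exists>j'<n'. a' = {..<m'} \<times> {j'}"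
proof -
  have N': "0 < N" using N by simp
  obtain x' where x': "x' < m'" "\<rho> 0 = \<rho>' x'"
    using similar_partner[OF r finite_lessThan N', of 0] m by auto
  obtain k where k: "k < n'" "\<gamma> j = \<gamma>' k"
    using similar_partner[OF c finite_lessThan N', of j] j by auto
  \<comment> \<open>The cells \<open>(0, j)\<close> and \<open>(0, y)\<close> both match
    \<open>(x', k)\<close>, so \<open>(0, y)\<close> lies in \<open>a\<close>, which is contained in
    column \<open>j\<close>.\<close>
  have "y = j" if "y < n" "\<gamma> y = \<gamma> j" for y
    using corr_iff[OF a m j(1) x'(1) k(1) x'(2) k(2)] corr_iff[OF a m that(1) x'(1) k(1) x'(2)] k that j m
    by auto
  then have "{y\<in>{..<n}. \<gamma> y = \<gamma> j} = {j}" using j by auto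
  then obtain j' where j': "{y\<in>{..<n'}. \<gamma>' y = \<gamma> j} = {j'}"
    by (rule similar_singleton[OF c N])
  have "j' \<in> {y\<in>{..<n'}. \<gamma>' y = \<gamma> j}" unfolding j' by simp
  then have j'': "j' < n'" "\<gamma> j = \<gamma>' j'" by simp_all
  have "(u, v) \<in> a' \<longleftrightarrow> u < m' \<and> v = j'" for u v
  proof
    assume uv: "(u, v) \<in> a'"
    then have lt: "u < m'" "v < n'" using a unfolding corr_def by auto
    obtain x where x: "x < m" "\<rho> x = \<rho>' u"
      using similar_partner[OF similar_sym[OF r] finite_lessThan, of u] lt N by auto
    obtain y where y: "y < n" "\<gamma> y = \<gamma>' v"
      using similar_partner[OF similar_sym[OF c] finite_lessThan, of v] lt N by auto
    have "y = j" using corr_iff[OF a x(1) y(1) lt x(2) y(2)] uv j by auto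
    then have "v \<in> {y\<in>{..<n'}. \<gamma>' y = \<gamma> j}" using lt y by simp
    then show "u < m' \<and> v = j'" unfolding j' using lt by simp
  next
    assume uv: "u < m' \<and> v = j'"
    obtain x where x: "x < m" "\<rho> x = \<rho>' u"
      using similar_partner[OF similar_sym[OF r] finite_lessThan, of u] uv N by auto
    show "(u, v) \<in> a'" using corr_iff[OF a x(1) j(1) _ j''(1) x(2) j''(2)] uv x j by auto
  qed
  then have "a' = {..<m'} \<times> {j'}" by auto
  then show ?thesis using j'' by blast
qed

text \<open>The relation \<open>join\<close> is a combination of equalities between unions,
  intersections, the empty set and the grid, and of the property of being a full column; each of
  these transfers.\<close>

lemma corr_join:
  assumes r: "similar N {..<m} {..<m'} \<rho> \<rho>'" and c: "similar N {..<n} {..<n'} \<gamma> \<gamma>'" and N: "2 \<le> N"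
    and m: "0 < m" "0 < m'"
    and a: "corr m n m' n' \<rho> \<gamma> \<rho>' \<gamma>' a a'" and b: "corr m n m' n' \<rho> \<gamma> \<rho>' \<gamma>' b b'"
    and d: "corr m n m' n' \<rho> \<gamma> \<rho>' \<gamma>' d d'"
  shows "join m n a b d \<longleftrightarrow> join m' n' a' b' d'"
proof -
  note eq = corr_eq[OF r c N]
  have "(\<exists>j<n. a \<union> b = {..<m} \<times> {j}) \<longleftrightarrow> (\<exists>j<n'. a' \<union> b' = {..<m'} \<times> {j})"
    using corr_full_column[OF r c N corr_Un[OF a b] m(1)]
      corr_full_column[OF similar_sym[OF r] similar_sym[OF c] N corr_sym[OF corr_Un[OF a b]] m(2)]
    by blast
  then show ?thesis
    unfolding join_def using eq[OF corr_Int[OF a b] corr_empty] eq[OF d corr_Un[OF a b]]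
      eq[OF d corr_grid] by simp
qed

section \<open>One move of the game\<close>

text \<open>The answer to a rectangle is the rectangle of the answers to its two sides. Sides of
  size 1 and full sides are preserved, so the answer satisfies the same clause of
  \<open>elems\<close>.\<close>

lemma corr_forth:
  assumes r: "similar (2 * N) {..<m} {..<m'} \<rho> \<rho>'" and c: "similar (2 * N) {..<n} {..<n'} \<gamma> \<gamma>'"
    and N: "2 \<le> N" and a: "a \<in> elems m n"
  obtains X Y X' Y' a' where
    "a' \<in> elems m' n'"
    "similar N {..<m} {..<m'} (\<lambda>x. (x \<in> X) # \<rho> x) (\<lambda>x. (x \<in> X') # \<rho>' x)"
    "similar N {..<n} {..<n'} (\<lambda>x. (x \<in> Y) # \<gamma> x) (\<lambda>x. (x \<in> Y') # \<gamma>' x)"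
    "corr m n m' n' (\<lambda>x. (x \<in> X) # \<rho> x) (\<lambda>x. (x \<in> Y) # \<gamma> x) (\<lambda>x. (x \<in> X') # \<rho>' x)
       (\<lambda>x. (x \<in> Y') # \<gamma>' x) a a'"
proof -
  obtain X Y where XY: "a = X \<times> Y" "X \<subseteq> {..<m}" "Y \<subseteq> {..<n}"
    "card X = 1 \<or> card Y = 1 \<and> X \<noteq> {..<m} \<or> X = {..<m} \<and> Y = {..<n}"
    using a unfolding elems_def by blast
  obtain X' where X': "X' \<subseteq> {..<m'}"
      "similar N {..<m} {..<m'} (\<lambda>x. (x \<in> X) # \<rho> x) (\<lambda>x. (x \<in> X') # \<rho>' x)"
    using similar_refine[OF r finite_lessThan finite_lessThan XY(2)] by blast
  obtain Y' where Y': "Y' \<subseteq> {..<n'}"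
      "similar N {..<n} {..<n'} (\<lambda>x. (x \<in> Y) # \<gamma> x) (\<lambda>x. (x \<in> Y') # \<gamma>' x)"
    using similar_refine[OF c finite_lessThan finite_lessThan XY(3)] by blast
  note full = refine_full[OF X'(2) finite_lessThan finite_lessThan N XY(2) X'(1)]
    refine_full[OF Y'(2) finite_lessThan finite_lessThan N XY(3) Y'(1)]
  note one = refine_card_1[OF X'(2) finite_lessThan N XY(2) X'(1)]
    refine_card_1[OF Y'(2) finite_lessThan N XY(3) Y'(1)]
  have mem: "X' \<times> Y' \<in> elems m' n'"
    unfolding elems_def using X'(1) Y'(1) XY(4) full one by blast
  show thesis
    by (rule that[OF mem X'(2) Y'(2)]) (use XY(1-3) X'(1) Y'(1) in \<open>auto simp: corr_def\<close>)
qed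

text \<open>Equal refined colours imply equal old colours, so refining only weakens the condition
  and earlier pairs stay related.\<close>

lemma corr_refined:
  assumes "corr m n m' n' \<rho> \<gamma> \<rho>' \<gamma>' a a'"
  shows "corr m n m' n' (\<lambda>x. P x # \<rho> x) (\<lambda>x. Q x # \<gamma> x) (\<lambda>x. P' x # \<rho>' x) (\<lambda>x. Q' x # \<gamma>' x) a a'"
  using assms by (simp add: corr_def)


section \<open>Large grids satisfy the same sentences of bounded quantifier rank\<close>

text \<open>The map \<open>f\<close> copies the grid algebra into an arbitrary type, where it has to
  live because axiomatisability is stated over a fixed type of elements. Every composition is the
  copy of the empty set.\<close>

definition grid_struct :: "((nat \<times> nat) set \<Rightarrow> 'a) \<Rightarrow> nat \<Rightarrow> nat \<Rightarrow> 'a fo_struct" where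
  "grid_struct f m n =
     \<lparr>fo_univ = f ` elems m n,
      fo_J = (\<lambda>x y z. \<exists>a\<in>elems m n. \<exists>b\<in>elems m n. \<exists>c\<in>elems m n.
                x = f a \<and> y = f b \<and> z = f c \<and> join m n a b c),
      fo_semi = (\<lambda>x y. f {}), fo_zero = f {}\<rparr>"

lemma grid_J:
  assumes "inj_on f (elems m n)" "a \<in> elems m n" "b \<in> elems m n" "c \<in> elems m n"
  shows "fo_J (grid_struct f m n) (f a) (f b) (f c) \<longleftrightarrow> join m n a b c"
proof
  assume "fo_J (grid_struct f m n) (f a) (f b) (f c)"
  then obtain a' b' c' where "a' \<in> elems m n" "b' \<in> elems m n" "c' \<in> elems m n"
    "f a = f a'" "f b = f b'" "f c = f c'" "join m n a' b' c'"
    unfolding grid_struct_def by auto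
  then show "join m n a b c" using assms inj_onD[OF assms(1)] by metis
qed (use assms in \<open>auto simp: grid_struct_def\<close>)

text \<open>With \<open>k\<close> rounds left the threshold is \<open>2 ^ Suc k\<close>: it halves
  in each round and is still 2 at the end, as needed to recognise full columns.\<close>

lemma grid_models_iff:
  assumes f: "inj_on f (elems m n)" and f': "inj_on f' (elems m' n')"
    and le: "2 ^ Suc k \<le> m" "2 ^ Suc k \<le> m'" "2 ^ Suc k \<le> n" "2 ^ Suc k \<le> n'"
    and \<phi>: "sentence S \<phi>" "qrank \<phi> \<le> k"
  shows "models (grid_struct f m n) \<phi> \<longleftrightarrow> models (grid_struct f' m' n') \<phi>"
proof -
  \<comment> \<open>A position relates all pairs that fit the colourings, not just the elements
    played. This makes the pair of zeros, and so every pair of compositions, related at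
    once.\<close>
  define pos where "pos \<rho> \<gamma> \<rho>' \<gamma>' = (\<lambda>x x'. \<exists>a\<in>elems m n. \<exists>a'\<in>elems m' n'.
      x = f a \<and> x' = f' a' \<and> corr m n m' n' \<rho> \<gamma> \<rho>' \<gamma>' a a')"
    for \<rho> \<gamma> \<rho>' \<gamma>' :: "nat \<Rightarrow> bool list"
  define Z where "Z k p \<longleftrightarrow> (\<exists>\<rho> \<gamma> \<rho>' \<gamma>'. similar (2 ^ Suc k) {..<m} {..<m'} \<rho> \<rho>' \<and>
      similar (2 ^ Suc k) {..<n} {..<n'} \<gamma> \<gamma>' \<and> p = pos \<rho> \<gamma> \<rho>' \<gamma>')" for k p
  have two: "(2::nat) \<le> 2 ^ Suc k" for k by simp
  then have m: "0 < m" "0 < m'" using le by (metis gr_zeroI le_zero_eq zero_neq_numeral)+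
  have zero: "p (f {}) (f' {})" if "Z k p" for k p
    using that empty_elem m corr_empty unfolding Z_def pos_def by blast
  have refined: "pos \<rho> \<gamma> \<rho>' \<gamma>' \<le>
      pos (\<lambda>x. P x # \<rho> x) (\<lambda>x. Q x # \<gamma> x) (\<lambda>x. P' x # \<rho>' x) (\<lambda>x. Q' x # \<gamma>' x)"
    for \<rho> \<gamma> \<rho>' \<gamma>' P Q P' Q'
  proof (intro le_funI le_boolI)
    fix x x' assume "pos \<rho> \<gamma> \<rho>' \<gamma>' x x'"
    then obtain a a' where "a \<in> elems m n" "a' \<in> elems m' n'" "x = f a" "x' = f' a'"
      and corr: "corr m n m' n' \<rho> \<gamma> \<rho>' \<gamma>' a a'" unfolding pos_def by blast
    then show "pos (\<lambda>x. P x # \<rho> x) (\<lambda>x. Q x # \<gamma> x) (\<lambda>x. P' x # \<rho>' x) (\<lambda>x. Q' x # \<gamma>' x) x x'"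
      unfolding pos_def using corr_refined[OF corr] by blast
  qed
  have "sat (grid_struct f m n) (\<lambda>_. f {}) \<phi> \<longleftrightarrow> sat (grid_struct f' m' n') (\<lambda>_. f' {}) \<phi>"
  proof (rule back_and_forth[where Z = Z and p = "pos (\<lambda>_. []) (\<lambda>_. []) (\<lambda>_. []) (\<lambda>_. [])" and k = k])
    show "Z k (pos (\<lambda>_. []) (\<lambda>_. []) (\<lambda>_. []) (\<lambda>_. []))"
    proof -
      \<comment> \<open>Initially all rows, and all columns, have the colour \<open>[]\<close>, and
        both sizes of this single class reach the threshold.\<close>
      have "similar (2 ^ Suc k) {..<u} {..<v} (\<lambda>_. [] :: bool list) (\<lambda>_. [])"
        if "2 ^ Suc k \<le> u" "2 ^ Suc k \<le> v" for u v :: nat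
        unfolding similar_def
      proof
        fix c :: "bool list"
        show "min (2 ^ Suc k) (card {x\<in>{..<u}. [] = c}) = min (2 ^ Suc k) (card {x\<in>{..<v}. [] = c})"
          using that by (cases c) (simp_all del: power_Suc)
      qed
      then show ?thesis unfolding Z_def using le by blast
    qed
    then show "pos (\<lambda>_. []) (\<lambda>_. []) (\<lambda>_. []) (\<lambda>_. []) (f {}) (f' {})" by (rule zero)
  next
    fix k p assume "Z k p"
    then show "p (fo_zero (grid_struct f m n)) (fo_zero (grid_struct f' m' n'))"
      using zero by (simp add: grid_struct_def)
  next
    fix k p a a' b b' assume "Z k p"
    then show "p (fo_semi (grid_struct f m n) a b) (fo_semi (grid_struct f' m' n') a' b')"
      using zero by (simp add: grid_struct_def)
  next
    fix k p x x' y y' assume "Z k p" and p: "p x x'" "p y y'"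
    then obtain \<rho> \<gamma> \<rho>' \<gamma>' where *: "similar (2 ^ Suc k) {..<m} {..<m'} \<rho> \<rho>'"
      "similar (2 ^ Suc k) {..<n} {..<n'} \<gamma> \<gamma>'" "p = pos \<rho> \<gamma> \<rho>' \<gamma>'" unfolding Z_def by blast
    obtain a a' where a: "a \<in> elems m n" "a' \<in> elems m' n'" "x = f a" "x' = f' a'"
      "corr m n m' n' \<rho> \<gamma> \<rho>' \<gamma>' a a'" using p(1) unfolding *(3) pos_def by blast
    obtain b b' where b: "b \<in> elems m n" "b' \<in> elems m' n'" "y = f b" "y' = f' b'"
      "corr m n m' n' \<rho> \<gamma> \<rho>' \<gamma>' b b'" using p(2) unfolding *(3) pos_def by blast
    show "x = y \<longleftrightarrow> x' = y'"
      using corr_eq[OF *(1,2) two a(5) b(5)] inj_on_eq_iff[OF f a(1) b(1)] inj_on_eq_iff[OF f' a(2) b(2)]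
        a(3,4) b(3,4) by simp
  next
    fix k p x x' y y' z z' assume "Z k p" and p: "p x x'" "p y y'" "p z z'"
    then obtain \<rho> \<gamma> \<rho>' \<gamma>' where *: "similar (2 ^ Suc k) {..<m} {..<m'} \<rho> \<rho>'"
      "similar (2 ^ Suc k) {..<n} {..<n'} \<gamma> \<gamma>'" "p = pos \<rho> \<gamma> \<rho>' \<gamma>'" unfolding Z_def by blast
    obtain a a' where a: "a \<in> elems m n" "a' \<in> elems m' n'" "x = f a" "x' = f' a'"
      "corr m n m' n' \<rho> \<gamma> \<rho>' \<gamma>' a a'" using p(1) unfolding *(3) pos_def by blast
    obtain b b' where b: "b \<in> elems m n" "b' \<in> elems m' n'" "y = f b" "y' = f' b'"
      "corr m n m' n' \<rho> \<gamma> \<rho>' \<gamma>' b b'" using p(2) unfolding *(3) pos_def by blast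
    obtain c c' where c: "c \<in> elems m n" "c' \<in> elems m' n'" "z = f c" "z' = f' c'"
      "corr m n m' n' \<rho> \<gamma> \<rho>' \<gamma>' c c'" using p(3) unfolding *(3) pos_def by blast
    show "fo_J (grid_struct f m n) x y z \<longleftrightarrow> fo_J (grid_struct f' m' n') x' y' z'"
      using corr_join[OF *(1,2) two m a(5) b(5) c(5)] grid_J[OF f a(1) b(1) c(1)]
        grid_J[OF f' a(2) b(2) c(2)] a(3,4) b(3,4) c(3,4) by simp
  next
    fix k p x assume "Z (Suc k) p" and "x \<in> fo_univ (grid_struct f m n)"
    then obtain \<rho> \<gamma> \<rho>' \<gamma>' a where r: "similar (2 * 2 ^ Suc k) {..<m} {..<m'} \<rho> \<rho>'"
      and c: "similar (2 * 2 ^ Suc k) {..<n} {..<n'} \<gamma> \<gamma>'" and p: "p = pos \<rho> \<gamma> \<rho>' \<gamma>'"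
      and a: "a \<in> elems m n" "x = f a" unfolding Z_def by (auto simp: grid_struct_def)
    obtain X Y X' Y' a' where *: "a' \<in> elems m' n'"
      "similar (2 ^ Suc k) {..<m} {..<m'} (\<lambda>x. (x \<in> X) # \<rho> x) (\<lambda>x. (x \<in> X') # \<rho>' x)"
      "similar (2 ^ Suc k) {..<n} {..<n'} (\<lambda>x. (x \<in> Y) # \<gamma> x) (\<lambda>x. (x \<in> Y') # \<gamma>' x)"
      "corr m n m' n' (\<lambda>x. (x \<in> X) # \<rho> x) (\<lambda>x. (x \<in> Y) # \<gamma> x) (\<lambda>x. (x \<in> X') # \<rho>' x)
         (\<lambda>x. (x \<in> Y') # \<gamma>' x) a a'"
      by (rule corr_forth[OF r c two a(1)])
    let ?q = "pos (\<lambda>x. (x \<in> X) # \<rho> x) (\<lambda>x. (x \<in> Y) # \<gamma> x) (\<lambda>x. (x \<in> X') # \<rho>' x) (\<lambda>x. (x \<in> Y') # \<gamma>' x)"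
    have "Z k ?q" unfolding Z_def using *(2,3) by blast
    moreover have "p \<le> ?q" unfolding p by (rule refined)
    moreover have "?q x (f' a')" unfolding pos_def using a *(1,4) by blast
    ultimately show "\<exists>x'\<in>fo_univ (grid_struct f' m' n'). \<exists>q. Z k q \<and> p \<le> q \<and> q x x'"
      using *(1) by (intro bexI[of _ "f' a'"]) (auto simp: grid_struct_def)
  next
    fix k p x' assume "Z (Suc k) p" and "x' \<in> fo_univ (grid_struct f' m' n')"
    then obtain \<rho> \<gamma> \<rho>' \<gamma>' a' where r: "similar (2 * 2 ^ Suc k) {..<m} {..<m'} \<rho> \<rho>'"
      and c: "similar (2 * 2 ^ Suc k) {..<n} {..<n'} \<gamma> \<gamma>'" and p: "p = pos \<rho> \<gamma> \<rho>' \<gamma>'"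
      and a: "a' \<in> elems m' n'" "x' = f' a'" unfolding Z_def by (auto simp: grid_struct_def)
    obtain X' Y' X Y a where *: "a \<in> elems m n"
      "similar (2 ^ Suc k) {..<m'} {..<m} (\<lambda>x. (x \<in> X') # \<rho>' x) (\<lambda>x. (x \<in> X) # \<rho> x)"
      "similar (2 ^ Suc k) {..<n'} {..<n} (\<lambda>x. (x \<in> Y') # \<gamma>' x) (\<lambda>x. (x \<in> Y) # \<gamma> x)"
      "corr m' n' m n (\<lambda>x. (x \<in> X') # \<rho>' x) (\<lambda>x. (x \<in> Y') # \<gamma>' x) (\<lambda>x. (x \<in> X) # \<rho> x)
         (\<lambda>x. (x \<in> Y) # \<gamma> x) a' a"
      by (rule corr_forth[OF similar_sym[OF r] similar_sym[OF c] two a(1)])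
    let ?q = "pos (\<lambda>x. (x \<in> X) # \<rho> x) (\<lambda>x. (x \<in> Y) # \<gamma> x) (\<lambda>x. (x \<in> X') # \<rho>' x) (\<lambda>x. (x \<in> Y') # \<gamma>' x)"
    have "Z k ?q" unfolding Z_def using *(2,3)[THEN similar_sym] by blast
    moreover have "p \<le> ?q" unfolding p by (rule refined)
    moreover have "?q (f a) x'" unfolding pos_def using a *(1) corr_sym[OF *(4)] by blast
    ultimately show "\<exists>x\<in>fo_univ (grid_struct f m n). \<exists>q. Z k q \<and> p \<le> q \<and> q x x'"
      using *(1) by (intro bexI[of _ "f a"]) (auto simp: grid_struct_def)
  qed (use \<phi> in auto)
  then show ?thesis
    unfolding models_sentence[OF \<phi>(1), of "grid_struct f m n" "\<lambda>_. f {}"]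
      models_sentence[OF \<phi>(1), of "grid_struct f' m' n'" "\<lambda>_. f' {}"] .
qed

section \<open>Pigeonhole: representability forces at least as many rows as columns\<close>

text \<open>For partial functions \<open>h\<close> takes domains, which turns domain-disjoint unions
  into disjoint unions, so one argument covers sets and functions. Injectivity is not claimed, as
  distinct functions may share a domain.\<close>

lemma representable_struct_hom:
  assumes rep: "representable_struct TYPE('b) \<sigma> M"
    and Join: "Join \<in> abstract_sym ` \<sigma>"
  obtains h :: "'a \<Rightarrow> 'b set" where
    "\<And>x y z. x \<in> fo_univ M \<Longrightarrow> y \<in> fo_univ M \<Longrightarrow> z \<in> fo_univ M \<Longrightarrow> fo_J M x y z \<Longrightarrow>
       h x \<inter> h y = {} \<and> h z = h x \<union> h y"
    "\<And>x y. x \<in> fo_univ M \<Longrightarrow> y \<in> fo_univ M \<Longrightarrow> h x \<inter> h y = {} \<Longrightarrow> \<exists>z\<in>fo_univ M. fo_J M x y z"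
proof -
  obtain A :: "'a palg" where A: "representable TYPE('b) \<sigma> A" "structure_of (abstract_sym ` \<sigma>) A M"
    using rep unfolding representable_struct_def by blast
  have U: "fo_univ M = pa_univ A" using A(2) by (simp add: structure_of_def)
  have J: "fo_J M x y z \<longleftrightarrow> pa_oper A Join [x, y] = Some z"
    if "x \<in> pa_univ A" "y \<in> pa_univ A" "z \<in> pa_univ A" for x y z
    using A(2) Join that by (simp add: structure_of_def)
  have closed: "z \<in> pa_univ A"
    if "x \<in> pa_univ A" "y \<in> pa_univ A" "pa_oper A Join [x, y] = Some z" for x y z
  proof -
    have "length [x, y] = arity Join \<and> set [x, y] \<subseteq> pa_univ A" using that by simp
    then show ?thesis using A(1) Join that(3) unfolding representable_def partial_algebra_def by blast
  qed
  have iso: "(pa_oper A Join [x, y] \<noteq> None \<longleftrightarrow> pa_oper B Join [\<theta> x, \<theta> y] \<noteq> None) \<and>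
       (\<forall>z. pa_oper A Join [x, y] = Some z \<longrightarrow> pa_oper B Join [\<theta> x, \<theta> y] = Some (\<theta> z))"
    if "palg_iso (abstract_sym ` \<sigma>) \<theta> A B" "x \<in> pa_univ A" "y \<in> pa_univ A"
    for \<theta> :: "'a \<Rightarrow> 'c" and B x y
  proof -
    have "length [x, y] = arity Join \<and> set [x, y] \<subseteq> pa_univ A" using that by simp
    then show ?thesis using that(1) Join unfolding palg_iso_def
      by (metis (no_types, lifting) list.simps(8,9))
  qed
  consider B :: "'b set palg" and \<theta> where "palg_of_sets \<sigma> B" "palg_iso (abstract_sym ` \<sigma>) \<theta> A B"
    | B :: "('b \<times> 'b) set palg" and \<theta> where "palg_of_pfuns \<sigma> B" "palg_iso (abstract_sym ` \<sigma>) \<theta> A B"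
    using A(1) unfolding representable_def palg_isomorphic_def by blast
  then show thesis
  proof cases
    case (1 B \<theta>)
    have op: "pa_oper B Join [X, Y] = (if X \<inter> Y = {} then Some (X \<union> Y) else None)" for X Y
      using 1(1) by (simp add: palg_of_sets_def)
    note i = iso[OF 1(2), unfolded op]
    show thesis
    proof (rule that[of \<theta>])
      fix x y z assume "x \<in> fo_univ M" "y \<in> fo_univ M" "z \<in> fo_univ M" "fo_J M x y z"
      then show "\<theta> x \<inter> \<theta> y = {} \<and> \<theta> z = \<theta> x \<union> \<theta> y"
        using i[of x y] J[of x y z] unfolding U by (auto split: if_splits)
    next
      fix x y assume "x \<in> fo_univ M" "y \<in> fo_univ M" "\<theta> x \<inter> \<theta> y = {}"
      then show "\<exists>z\<in>fo_univ M. fo_J M x y z"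
        using i[of x y] J[of x y] closed[of x y] unfolding U by auto
    qed
  next
    case (2 B \<theta>)
    have op: "pa_oper B Join [X, Y] = (if Domain X \<inter> Domain Y = {} then Some (X \<union> Y) else None)" for X Y
      using 2(1) by (simp add: palg_of_pfuns_def)
    note i = iso[OF 2(2), unfolded op]
    show thesis
    proof (rule that[of "\<lambda>x. Domain (\<theta> x)"])
      fix x y z assume "x \<in> fo_univ M" "y \<in> fo_univ M" "z \<in> fo_univ M" "fo_J M x y z"
      then have "Domain (\<theta> x) \<inter> Domain (\<theta> y) = {} \<and> \<theta> z = \<theta> x \<union> \<theta> y"
        using i[of x y] J[of x y z] unfolding U by (auto split: if_splits)
      then show "Domain (\<theta> x) \<inter> Domain (\<theta> y) = {} \<and> Domain (\<theta> z) = Domain (\<theta> x) \<union> Domain (\<theta> y)"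
        by (simp add: Domain_Un_eq)
    next
      fix x y assume "x \<in> fo_univ M" "y \<in> fo_univ M" "Domain (\<theta> x) \<inter> Domain (\<theta> y) = {}"
      then show "\<exists>z\<in>fo_univ M. fo_J M x y z"
        using i[of x y] J[of x y] closed[of x y] unfolding U by auto
    qed
  qed
qed

text \<open>A point \<open>u\<close> in the image of the grid lies in the image of some cell
  \<open>(s j, j)\<close> of every column \<open>j\<close>. Cells of the same row have disjoint
  images, so \<open>s\<close> is an injection from columns to rows.\<close>

lemma representable_grid_le:
  assumes f: "inj_on f (elems m n)" and m: "0 < m" and n: "0 < n" and Join: "Join \<in> abstract_sym ` \<sigma>"
    and rep: "representable_struct TYPE('b) \<sigma> (grid_struct f m n)"
  shows "n \<le> m"
proof -
  let ?M = "grid_struct f m n"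
  obtain h where h:
    "\<And>x y z. x \<in> fo_univ ?M \<Longrightarrow> y \<in> fo_univ ?M \<Longrightarrow> z \<in> fo_univ ?M \<Longrightarrow> fo_J ?M x y z \<Longrightarrow>
       h x \<inter> h y = {} \<and> h z = h x \<union> (h y :: 'b set)"
    "\<And>x y. x \<in> fo_univ ?M \<Longrightarrow> y \<in> fo_univ ?M \<Longrightarrow> h x \<inter> h y = {} \<Longrightarrow> \<exists>z\<in>fo_univ ?M. fo_J ?M x y z"
    by (rule representable_struct_hom[OF rep Join]) (rule that)
  define g where "g a = h (f a)" for a
  have U: "f a \<in> fo_univ ?M" if "a \<in> elems m n" for a using that by (simp add: grid_struct_def)
  have g: "g a \<inter> g b = {} \<and> g c = g a \<union> g b"
    if "a \<in> elems m n" "b \<in> elems m n" "c \<in> elems m n" "join m n a b c" for a b c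
    unfolding g_def using h(1)[OF U U U] grid_J[OF f] that by blast
  \<comment> \<open>An empty image would be disjoint from itself, so the join of the grid with
    itself would be defined, although the nonempty grid meets itself.\<close>
  have "g ({..<m} \<times> {..<n}) \<noteq> {}"
  proof
    assume "g ({..<m} \<times> {..<n}) = {}"
    then obtain z where "z \<in> fo_univ ?M" "fo_J ?M (f ({..<m} \<times> {..<n})) (f ({..<m} \<times> {..<n})) z"
      using h(2)[OF U[OF grid_elem] U[OF grid_elem]] unfolding g_def by blast
    then obtain c where "c \<in> elems m n" "z = f c" "fo_J ?M (f ({..<m} \<times> {..<n})) (f ({..<m} \<times> {..<n})) (f c)"
      by (auto simp: grid_struct_def)
    then have "join m n ({..<m} \<times> {..<n}) ({..<m} \<times> {..<n}) c"
      using grid_J[OF f grid_elem grid_elem] by blast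
    then have "{..<m} \<times> {..<n} = {}" unfolding join_def by blast
    then show False using m n by (simp add: times_eq_iff lessThan_empty_iff)
  qed
  then obtain u where u: "u \<in> g ({..<m} \<times> {..<n})" by blast
  have empty: "g {} = {}"
    using g[of "{}" "{}" "{}"] empty_elem[OF m] by (auto simp: join_def)
  have pt: "{(i, j)} \<in> elems m n" if "i < m" "j < n" for i j
    using row_elem[of i m "{j}" n] that by simp
  \<comment> \<open>Adding the cells one at a time stays below the full column, so each partial
    union is an element and each join is an ordinary union.\<close>
  have part: "\<exists>i\<in>X. u \<in> g {(i, j)}"
    if "X \<subseteq> {..<m}" "X \<noteq> {..<m}" "j < n" "u \<in> g (X \<times> {j})" for X j
  proof -
    have "finite X" using that(1) finite_subset by blast
    then show ?thesis using that
    proof (induction X rule: finite_induct)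
      case empty then show ?case using \<open>g {} = {}\<close> by simp
    next
      case (insert i X)
      have X: "X \<subseteq> {..<m}" "X \<noteq> {..<m}" "i < m" using insert by auto
      have "join m n {(i, j)} (X \<times> {j}) (insert i X \<times> {j})"
        unfolding join_def using insert.hyps by auto
      then have "g (insert i X \<times> {j}) = g {(i, j)} \<union> g (X \<times> {j})"
        using g[OF pt column_elem column_elem] insert.prems X by blast
      then show ?case using insert X by auto
    qed
  qed
  have "\<exists>i<m. u \<in> g {(i, j)}" if j: "j < n" for j
  proof -
    \<comment> \<open>A full column need not be an element; without its cell in row 0 it is one, and
      the join with that cell is the whole grid.\<close>
    let ?X = "{..<m} - {0}"
    have X: "?X \<subseteq> {..<m}" "?X \<noteq> {..<m}" using m by auto
    have "{(0, j)} \<union> ?X \<times> {j} = {..<m} \<times> {j}" using m by auto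
    then have "join m n {(0, j)} (?X \<times> {j}) ({..<m} \<times> {..<n})"
      unfolding join_def using j by auto
    then have "g ({..<m} \<times> {..<n}) = g {(0, j)} \<union> g (?X \<times> {j})"
      using g[OF pt[OF m j] column_elem[OF j X] grid_elem] by blast
    then show ?thesis using u part[OF X j] m by blast
  qed
  then obtain s where s: "\<And>j. j < n \<Longrightarrow> s j < m \<and> u \<in> g {(s j, j)}" by metis
  have "inj_on s {..<n}"
  proof (rule inj_onI, rule ccontr)
    fix j j' assume j: "j \<in> {..<n}" "j' \<in> {..<n}" and eq: "s j = s j'" and ne: "j \<noteq> j'"
    \<comment> \<open>A pair of cells in one row is an element, so the two cells have a join and
      hence disjoint images.\<close>
    have "join m n {(s j, j)} {(s j, j')} ({s j} \<times> {j, j'})"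
      unfolding join_def using ne by auto
    moreover have sj: "s j < m" "j < n" "j' < n" "{j, j'} \<subseteq> {..<n}" using s[of j] j by auto
    ultimately have "g {(s j, j)} \<inter> g {(s j, j')} = {}"
      using g[OF pt[OF sj(1,2)] pt[OF sj(1,3)] row_elem[OF sj(1,4)]] by blast
    then show False using s[of j] s[of j'] j eq by auto
  qed
  then have "card {..<n} \<le> card {..<m}" by (rule card_inj_on_le) (use s in auto)
  then show ?thesis by simp
qed

section \<open>Representing grid algebras with many rows\<close>

text \<open>These are total functions, arbitrary from argument \<open>n\<close> on; only their
  values on the \<open>n\<close> columns matter.\<close>

definition placements :: "nat \<Rightarrow> nat \<Rightarrow> (nat \<Rightarrow> nat) set" where
  "placements m n = {s. inj_on s {..<n} \<and> s ` {..<n} \<subseteq> {..<m}}"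

definition hit :: "nat \<Rightarrow> nat \<Rightarrow> (nat \<times> nat) set \<Rightarrow> (nat \<Rightarrow> nat) set" where
  "hit m n a = {s\<in>placements m n. \<exists>j<n. (s j, j) \<in> a}"

text \<open>The \<open>n\<close> columns are first injected into the rows other than
  \<open>i\<close>, \<open>i'\<close> and \<open>r\<close>, of which \<open>n + 3 \<le> m\<close>
  leaves at least \<open>n\<close>; then the values at \<open>j\<close> and \<open>j'\<close> are
  overwritten. Taking \<open>r = m\<close> forbids nothing, since placements have values below
  \<open>m\<close>.\<close>

lemma placement_exists:
  assumes "n + 3 \<le> m" "i < m" "i' < m" "j < n" "j' < n" "i \<noteq> i'" "j \<noteq> j'" "r \<noteq> i" "r \<noteq> i'"
  obtains s where "s \<in> placements m n" "s j = i" "s j' = i'" "\<And>k. k < n \<Longrightarrow> s k \<noteq> r"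
proof -
  have "card {..<m} - card {i, i', r} \<le> card ({..<m} - {i, i', r})"
    by (rule diff_card_le_card_Diff) simp
  moreover have "card {i, i', r} \<le> 3" by (simp add: card_insert_if)
  ultimately have "card {..<n} \<le> card ({..<m} - {i, i', r})" using assms(1) by simp
  then obtain s where s: "s ` {..<n} \<subseteq> {..<m} - {i, i', r}" "inj_on s {..<n}"
    using card_le_inj[of "{..<n}" "{..<m} - {i, i', r}"] by auto
  have "inj_on (s(j := i, j' := i')) {..<n}"
    using s assms unfolding inj_on_def by (auto simp: image_subset_iff)
  moreover have "(s(j := i, j' := i')) ` {..<n} \<subseteq> {..<m}" using s assms by auto
  ultimately have "s(j := i, j' := i') \<in> placements m n" by (simp add: placements_def)
  then show thesis by (rule that) (use assms s(1) in auto)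
qed

lemma ex_other: "3 \<le> m \<Longrightarrow> \<exists>k<m. k \<noteq> i \<and> k \<noteq> (r :: nat)"
proof (rule ccontr)
  assume m: "3 \<le> m" and no: "\<not> (\<exists>k<m. k \<noteq> i \<and> k \<noteq> r)"
  have "k = i \<or> k = r" if "k < m" for k using no that by blast
  from this[of 0] this[of 1] this[of 2] show False using m by auto
qed

text \<open>A second cell in another row and column, also off the row \<open>r\<close>, is added so
  that \<open>placement_exists\<close> applies; \<open>2 \<le> n\<close> provides the
  column.\<close>

lemma placement_through:
  assumes "n + 3 \<le> m" "2 \<le> n" "i < m" "j < n" "r \<noteq> i"
  obtains s where "s \<in> placements m n" "s j = i" "\<And>k. k < n \<Longrightarrow> s k \<noteq> r"
proof -
  obtain i' where i': "i' < m" "i' \<noteq> i" "i' \<noteq> r" using ex_other[of m i r] assms by auto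
  define j' :: nat where "j' = (if j = 0 then 1 else 0)"
  have "j' < n" "j \<noteq> j'" using assms by (auto simp: j'_def)
  then show thesis
    using placement_exists[of n m i i' j j' r] assms i' that by metis
qed

text \<open>For a part of row \<open>i\<close>, injectivity makes \<open>j\<close> the only column
  where the placement uses that row.\<close>

lemma hit_iff:
  assumes "s \<in> placements m n" "j < n" "s j = i"
  shows "(i, j) \<in> a \<Longrightarrow> s \<in> hit m n a"
    and "s \<in> hit m n ({i} \<times> Y) \<longleftrightarrow> j \<in> Y"
    and "s \<in> hit m n (X \<times> {j}) \<longleftrightarrow> i \<in> X"
  using assms unfolding hit_def placements_def inj_on_def by auto

lemma hit_Un: "hit m n (a \<union> b) = hit m n a \<union> hit m n b"
  unfolding hit_def by blast

lemma elem_collinear: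
  assumes "a \<in> elems m n" "a \<noteq> {..<m} \<times> {..<n}" "p \<in> a" "q \<in> a"
  shows "fst p = fst q \<or> snd p = snd q"
  using assms by (cases rule: elems_cases) auto

text \<open>A placement hitting both \<open>a\<close> and \<open>b\<close> uses cells in different
  rows and columns, so the union lies in no line and must be the grid. Neither part is the grid, so
  each lies in a line, and two lines cannot cover it.\<close>

lemma hit_join:
  assumes mn: "3 \<le> m" "3 \<le> n" and el: "a \<in> elems m n" "b \<in> elems m n" "c \<in> elems m n"
    and J: "join m n a b c"
  shows "hit m n a \<inter> hit m n b = {} \<and> hit m n c = hit m n a \<union> hit m n b"
proof
  have ab: "a \<inter> b = {}" using J by (simp add: join_def)
  show "hit m n a \<inter> hit m n b = {}"
  proof (rule ccontr)
    assume "hit m n a \<inter> hit m n b \<noteq> {}"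
    then obtain s j k where s: "s \<in> placements m n" "j < n" "k < n" "(s j, j) \<in> a" "(s k, k) \<in> b"
      unfolding hit_def by blast
    then have ne: "j \<noteq> k" "s j \<noteq> s k" using ab by (auto simp: placements_def inj_on_def)
    have mem: "(s j, j) \<in> a \<union> b" "(s k, k) \<in> a \<union> b" using s by auto
    have "\<nexists>l. a \<union> b = {..<m} \<times> {l}" using mem ne(1) by (metis SigmaD2 singletonD)
    then have "c = a \<union> b" using J by (auto simp: join_def)
    then have full: "a \<union> b = {..<m} \<times> {..<n}"
      using elem_collinear[OF el(3), of "(s j, j)" "(s k, k)"] mem ne by auto
    have "a \<noteq> {..<m} \<times> {..<n}" "b \<noteq> {..<m} \<times> {..<n}"
      using ab s elems_subset[OF el(1)] elems_subset[OF el(2)] by blast+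
    note line = elem_collinear[OF el(1) this(1)] elem_collinear[OF el(2) this(2)]
    \<comment> \<open>Two of these three cells would lie in the same part, but no two of them share
      a row or a column.\<close>
    have "(0, 0) \<in> a \<union> b" "(1, 1) \<in> a \<union> b" "(2, 2) \<in> a \<union> b" unfolding full using mn by auto
    then show False
      using line[of "(0, 0)" "(1, 1)"] line[of "(0, 0)" "(2, 2)"] line[of "(1, 1)" "(2, 2)"] by auto
  qed
  show "hit m n c = hit m n a \<union> hit m n b"
  proof (cases "c = a \<union> b")
    case True then show ?thesis by (simp add: hit_Un)
  next
    case False
    then obtain j where j: "j < n" "a \<union> b = {..<m} \<times> {j}" "c = {..<m} \<times> {..<n}"
      using J by (auto simp: join_def)
    \<comment> \<open>Every placement takes a value in column \<open>j\<close>, so it hits the full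
      column just as it hits the grid. This is why the two may be identified.\<close>
    have "s \<in> hit m n c \<longleftrightarrow> s \<in> hit m n (a \<union> b)" for s
      unfolding j(2,3) hit_def placements_def using j(1) by auto
    then show ?thesis by (auto simp: hit_Un)
  qed
qed

section \<open>Disjoint images come from joinable elements, and images determine elements\<close>

text \<open>Otherwise some \<open>q\<close> is off the row of \<open>p\<close> and some
  \<open>r\<close> is off its column. Then \<open>q\<close> is in the column of \<open>p\<close> and
  \<open>r\<close> in its row, so \<open>q\<close> and \<open>r\<close> share neither.\<close>

lemma collinear_in_line:
  assumes "\<And>p q. p \<in> A \<Longrightarrow> q \<in> A \<Longrightarrow> fst p = fst q \<or> snd p = snd q"
  shows "(\<exists>i. \<forall>p\<in>A. fst p = i) \<or> (\<exists>j. \<forall>p\<in>A. snd p = j)"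
proof (rule ccontr)
  assume "\<not> ?thesis"
  then have no: "\<And>i. \<exists>p\<in>A. fst p \<noteq> i" "\<And>j. \<exists>p\<in>A. snd p \<noteq> j" by blast+
  obtain p where p: "p \<in> A" using no(1) by blast
  obtain q where q: "q \<in> A" "fst q \<noteq> fst p" using no(1) by blast
  obtain r where r: "r \<in> A" "snd r \<noteq> snd p" using no(2) by blast
  show False using assms[OF p q(1)] assms[OF p r(1)] assms[OF q(1) r(1)] q(2) r(2) by auto
qed

text \<open>A cell of \<open>a\<close> and a cell of \<open>b\<close> in general position would lie
  on a common placement. Hence the cells of the union are pairwise collinear and fill part of a row,
  part of a column or a full column, each of which gives a join.\<close>

lemma hit_disjoint_join:
  assumes mn: "n + 3 \<le> m" "2 \<le> n" and el: "a \<in> elems m n" "b \<in> elems m n"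
    and disj: "hit m n a \<inter> hit m n b = {}"
  shows "\<exists>c\<in>elems m n. join m n a b c"
proof (cases "a = {} \<or> b = {}")
  case True
  then show ?thesis using el by (auto simp: join_def)
next
  case False
  note sub = elems_subset[OF el(1)] elems_subset[OF el(2)]
  have hits: "\<exists>s. s \<in> placements m n \<and> s (snd p) = fst p \<and> s (snd q) = fst q"
    if "p \<in> {..<m} \<times> {..<n}" "q \<in> {..<m} \<times> {..<n}" "fst p \<noteq> fst q \<and> snd p \<noteq> snd q \<or> p = q" for p q
  proof (cases "p = q")
    case True
    then show ?thesis
      using placement_through[OF mn, of "fst p" "snd p" m] that by (metis SigmaE fst_conv lessThan_iff less_irrefl snd_conv)
  next
    case False
    then show ?thesis
      using placement_exists[OF mn(1), of "fst p" "fst q" "snd p" "snd q" m] that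
      by (metis SigmaE fst_conv lessThan_iff less_irrefl snd_conv)
  qed
  have cross: "p \<noteq> q \<and> (fst p = fst q \<or> snd p = snd q)" if "p \<in> a" "q \<in> b" for p q
  proof (rule ccontr)
    assume "\<not> ?thesis"
    then have "fst p \<noteq> fst q \<and> snd p \<noteq> snd q \<or> p = q" by blast
    then obtain s where s: "s \<in> placements m n" "s (snd p) = fst p" "s (snd q) = fst q"
      using hits[of p q] \<open>p \<in> a\<close> \<open>q \<in> b\<close> sub by blast
    have "s \<in> hit m n a" "s \<in> hit m n b"
      using hit_iff(1)[OF s(1) _ s(2), of a] hit_iff(1)[OF s(1) _ s(3), of b] that sub by auto
    then show False using disj by blast
  qed
  have ab: "a \<inter> b = {}" using cross by blast
  have ne: "a \<noteq> {..<m} \<times> {..<n}" "b \<noteq> {..<m} \<times> {..<n}"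
    using cross sub False by blast+
  have "fst p = fst q \<or> snd p = snd q" if "p \<in> a \<union> b" "q \<in> a \<union> b" for p q
    using that cross[of p q] cross[of q p] elem_collinear[OF el(1) ne(1), of p q]
      elem_collinear[OF el(2) ne(2), of p q] by auto
  then consider i where "\<forall>p\<in>a \<union> b. fst p = i" | j where "\<forall>p\<in>a \<union> b. snd p = j"
    using collinear_in_line[of "a \<union> b"] by blast
  then show ?thesis
  proof cases
    case (1 i)
    let ?Y = "{y. (i, y) \<in> a \<union> b}"
    have eq: "a \<union> b = {i} \<times> ?Y" using 1 by force
    obtain p where "p \<in> a" using False by blast
    then have "p \<in> {..<m} \<times> {..<n}" "fst p = i" using 1 sub(1) by blast+
    then have "i < m" by (auto simp: mem_Times_iff)
    moreover have "?Y \<subseteq> {..<n}" using sub by auto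
    ultimately have "a \<union> b \<in> elems m n" using row_elem[of i m ?Y n] eq by simp
    then show ?thesis using ab unfolding join_def by blast
  next
    case (2 j)
    let ?X = "{x. (x, j) \<in> a \<union> b}"
    have eq: "a \<union> b = ?X \<times> {j}" using 2 by force
    obtain p where "p \<in> a" using False by blast
    then have "p \<in> {..<m} \<times> {..<n}" "snd p = j" using 2 sub(1) by blast+
    then have X: "j < n" "?X \<subseteq> {..<m}" using sub by (auto simp: mem_Times_iff)
    show ?thesis
    proof (cases "?X = {..<m}")
      case True
      then have "a \<union> b = {..<m} \<times> {j}" using eq by simp
      then have "join m n a b ({..<m} \<times> {..<n})" unfolding join_def using X(1) ab by blast
      then show ?thesis using grid_elem by blast
    next
      case False
      then have "a \<union> b \<in> elems m n" using column_elem[OF X False] eq by simp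
      then show ?thesis using ab unfolding join_def by blast
    qed
  qed
qed

text \<open>For a cell \<open>(i, j)\<close> of \<open>a\<close> outside \<open>b\<close>, every
  placement through it would have to hit \<open>b\<close>. Unless \<open>b\<close> lies in another
  column \<open>j'\<close>, some placement through the cell misses \<open>b\<close>; in that case
  \<open>b\<close> is pinned down and compared with each form of \<open>a\<close>.\<close>

lemma hit_subset:
  assumes mn: "n + 3 \<le> m" "2 \<le> n" and el: "a \<in> elems m n" "b \<in> elems m n"
    and eq: "hit m n a = hit m n b"
  shows "a \<subseteq> b"
proof (rule ccontr)
  assume "\<not> a \<subseteq> b"
  then obtain i j where p: "(i, j) \<in> a" "(i, j) \<notin> b" by auto
  then have ij: "i < m" "j < n" using elems_subset[OF el(1)] by auto
  note through = placement_through[OF mn]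
  note through2 = placement_exists[OF mn(1)]
  have hit_a: "s \<in> hit m n b" if "s \<in> placements m n" "s j = i" for s
    using hit_iff(1)[OF that(1) ij(2) that(2) p(1)] eq by simp
  show False
    using el(2)
  proof (cases rule: elems_cases)
    case (row i' Y)
    show False
    proof (cases "i' = i")
      case True
      obtain s where s: "s \<in> placements m n" "s j = i"
        by (rule through[OF ij, of m]) (use ij in auto)
      then show False using hit_a[OF s] hit_iff(2)[OF s(1) ij(2) s(2)] p row True by auto
    next
      case False
      obtain s where s: "s \<in> placements m n" "s j = i" "\<And>k. k < n \<Longrightarrow> s k \<noteq> i'"
        using through[OF ij False] by blast
      then show False using hit_a[OF s(1,2)] row by (auto simp: hit_def)
    qed
  next
    case (column j' X)
    show False
    proof (cases "j' = j")
      case True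
      obtain s where s: "s \<in> placements m n" "s j = i"
        by (rule through[OF ij, of m]) (use ij in auto)
      then show False using hit_a[OF s] hit_iff(3)[OF s(1) ij(2) s(2)] p column True by auto
    next
      case j': False
      \<comment> \<open>A placement through \<open>(i, j)\<close> can also pass through
        \<open>(i', j')\<close> and meets column \<open>j'\<close> nowhere else.\<close>
      have X: "i' \<in> X" if i': "i' < m" "i' \<noteq> i" for i'
      proof (rule ccontr)
        assume "i' \<notin> X"
        obtain s where s: "s \<in> placements m n" "s j = i" "s j' = i'"
          by (rule through2[of i i' j j' m]) (use ij i' column(1) j' in auto)
        then show False
          using hit_a[OF s(1,2)] hit_iff(3)[OF s(1) column(1) s(3)] column \<open>i' \<notin> X\<close> by auto
      qed
      \<comment> \<open>So \<open>b\<close> is column \<open>j'\<close> without its cell in row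
        \<open>i\<close>, and the placements that miss \<open>b\<close> are those passing through
        \<open>(i, j')\<close>.\<close>
      then have i: "i \<notin> X" using column(2) by auto
      show False
        using el(1)
      proof (cases rule: elems_cases)
        case (row i0 Y)
        then have "i0 = i" using p by auto
        \<comment> \<open>A placement that avoids row \<open>i\<close> altogether hits
          \<open>b\<close> in row \<open>i1\<close> but misses \<open>a\<close>.\<close>
        define i1 :: nat where "i1 = (if i = 0 then 1 else 0)"
        have i1: "i1 < m" "i1 \<noteq> i" using mn by (auto simp: i1_def)
        obtain s where s: "s \<in> placements m n" "s j' = i1" "\<And>k. k < n \<Longrightarrow> s k \<noteq> i"
          using through[OF i1(1) column(1), of i] i1 by metis
        have "s \<in> hit m n b" using hit_iff(3)[OF s(1) column(1) s(2)] X[OF i1] column by simp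
        moreover have "s \<notin> hit m n a" using s row \<open>i0 = i\<close> by (auto simp: hit_def)
        ultimately show False using eq by simp
      next
        case col: (column j0 X0)
        then have j0: "j0 = j" using p by auto
        \<comment> \<open>As \<open>a\<close> is a proper part of column \<open>j\<close>, a
          placement can leave it through row \<open>i2\<close> and still hit \<open>b\<close> in row
          \<open>i3\<close>.\<close>
        obtain i2 where i2: "i2 < m" "i2 \<notin> X0" using col by auto
        obtain i3 where i3: "i3 < m" "i3 \<noteq> i" "i3 \<noteq> i2"
          using ex_other[of m i i2] mn by auto
        obtain s where s: "s \<in> placements m n" "s j = i2" "s j' = i3"
          by (rule through2[of i2 i3 j j' m]) (use ij i2 i3 column j' in auto)
        have "s \<in> hit m n b" using hit_iff(3)[OF s(1) column(1) s(3)] X[OF i3(1,2)] column by simp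
        moreover have "s \<notin> hit m n a" using hit_iff(3)[OF s(1) ij(2) s(2)] i2 col j0 by simp
        ultimately show False using eq by simp
      next
        case grid
        \<comment> \<open>Every placement hits the grid, while one through \<open>(i, j')\<close>
          misses \<open>b\<close>.\<close>
        obtain s where s: "s \<in> placements m n" "s j' = i"
          by (rule through[OF ij(1) column(1), of m]) (use ij in auto)
        have "s \<in> hit m n a" using hit_iff(1)[OF s(1) column(1) s(2)] grid ij column(1) by simp
        then show False using hit_iff(3)[OF s(1) column(1) s(2)] eq column(3) i by simp
      qed
    qed
  next
    case grid
    then show False using p ij by simp
  qed
qed

section \<open>Representations from a homomorphism into sets\<close>

text \<open>The sets \<open>h x\<close> are turned into a concrete algebra. The extra point
  \<open>None\<close> is needed as a common value for partial functions; in the case of sets it only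
  makes the base types agree.\<close>

lemma hom_representable_struct:
  fixes h :: "'a \<Rightarrow> 'c set" and M :: "'a fo_struct"
  assumes \<sigma>: "DisjUnion \<in> \<sigma> \<and> Compose \<notin> \<sigma> \<or> DomDisjUnion \<in> \<sigma>"
    and inj: "inj_on h (fo_univ M)"
    and J: "\<And>x y z. x \<in> fo_univ M \<Longrightarrow> y \<in> fo_univ M \<Longrightarrow> z \<in> fo_univ M \<Longrightarrow> fo_J M x y z \<Longrightarrow>
       h x \<inter> h y = {} \<and> h z = h x \<union> h y"
    and ex: "\<And>x y. x \<in> fo_univ M \<Longrightarrow> y \<in> fo_univ M \<Longrightarrow> h x \<inter> h y = {} \<Longrightarrow> \<exists>z\<in>fo_univ M. fo_J M x y z"
    and semi: "\<And>x y. fo_semi M x y = fo_zero M"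
    and zero: "fo_zero M \<in> fo_univ M" "h (fo_zero M) = {}"
  shows "representable_struct TYPE('c option) \<sigma> M"
proof -
  let ?U = "fo_univ M"
  \<comment> \<open>The choice is unambiguous: \<open>J\<close> and the injectivity of
    \<open>h\<close> leave at most one \<open>z\<close>, as \<open>fn\<close> shows.\<close>
  define A where "A = \<lparr>pa_univ = ?U, pa_oper = (\<lambda>s xs. case s of
      Join \<Rightarrow> if \<exists>z\<in>?U. fo_J M (xs ! 0) (xs ! 1) z then Some (SOME z. z \<in> ?U \<and> fo_J M (xs ! 0) (xs ! 1) z) else None
    | Semi \<Rightarrow> Some (fo_zero M) | Zero \<Rightarrow> Some (fo_zero M))\<rparr>"
  have U: "pa_univ A = ?U" by (simp add: A_def)
  have fn: "z = z'" if "x \<in> ?U" "y \<in> ?U" "z \<in> ?U" "z' \<in> ?U" "fo_J M x y z" "fo_J M x y z'" for x y z z'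
    using J[OF that(1,2,3,5)] J[OF that(1,2,4,6)] inj_onD[OF inj] that by metis
  have join: "pa_oper A Join [x, y] = Some z \<longleftrightarrow> z \<in> ?U \<and> fo_J M x y z" if "x \<in> ?U" "y \<in> ?U" for x y z
  proof (cases "\<exists>z\<in>?U. fo_J M x y z")
    case True
    then have ex: "\<exists>z. z \<in> ?U \<and> fo_J M x y z" by blast
    have "pa_oper A Join [x, y] = Some (SOME z. z \<in> ?U \<and> fo_J M x y z)"
      using True by (simp add: A_def)
    then show ?thesis using someI_ex[OF ex] fn[OF that] by auto
  next
    case False
    then show ?thesis by (auto simp: A_def)
  qed
  have SZ: "pa_oper A Semi xs = Some (fo_zero M)" "pa_oper A Zero xs = Some (fo_zero M)" for xs
    by (simp_all add: A_def)
  have args: "(s = Zero \<and> xs = []) \<or> (\<exists>x\<in>?U. \<exists>y\<in>?U. (s = Join \<or> s = Semi) \<and> xs = [x, y])"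
    if "length xs = arity s" "set xs \<subseteq> ?U" for s xs
    using that by (cases s) (auto simp: numeral_2_eq_2 length_Suc_conv)
  have pA: "partial_algebra S A" for S
    unfolding partial_algebra_def U
  proof (intro ballI allI impI, elim conjE)
    fix s xs y assume "length xs = arity s" "set xs \<subseteq> ?U" "pa_oper A s xs = Some y"
    then show "y \<in> ?U" using args[of xs s] join SZ zero(1) by auto
  qed
  have str: "structure_of S A M" for S
    unfolding structure_of_def U using join SZ semi by simp
  have join': "(h x \<inter> h y = {} \<longrightarrow> (\<exists>z. pa_oper A Join [x, y] = Some z \<and> h z = h x \<union> h y)) \<and>
      (h x \<inter> h y \<noteq> {} \<longrightarrow> pa_oper A Join [x, y] = None)" if xy: "x \<in> ?U" "y \<in> ?U" for x y
  proof (intro conjI impI)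
    assume "h x \<inter> h y = {}"
    then obtain z where z: "z \<in> ?U" "fo_J M x y z" using ex[OF xy] by blast
    then show "\<exists>z. pa_oper A Join [x, y] = Some z \<and> h z = h x \<union> h y"
      using J[OF xy z] join[OF xy] by blast
  next
    assume "h x \<inter> h y \<noteq> {}"
    then show "pa_oper A Join [x, y] = None"
      using J[OF xy] join[OF xy] by (cases "pa_oper A Join [x, y]") blast+
  qed
  have "representable TYPE('c option) \<sigma> A"
    using \<sigma>
  proof
    assume D: "DisjUnion \<in> \<sigma> \<and> Compose \<notin> \<sigma>"
    define t :: "'a \<Rightarrow> 'c option set" where "t x = Some ` h x" for x
    define B where "B = \<lparr>pa_univ = t ` ?U, pa_oper = set_oper\<rparr>"
    have inj_t: "inj_on t (pa_univ A)"
      unfolding U t_def using inj by (auto simp: inj_on_def inj_image_eq_iff)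
    have uB: "pa_univ B = t ` pa_univ A" by (simp add: B_def U)
    have dis: "t x \<inter> t y = {} \<longleftrightarrow> h x \<inter> h y = {}" for x y unfolding t_def by auto
    have op: "pa_oper B s (map t xs) = map_option t (pa_oper A s xs)"
      if s: "s \<in> abstract_sym ` \<sigma>" and xs: "length xs = arity s" "set xs \<subseteq> pa_univ A" for s xs
    proof -
      obtain c where "c \<in> \<sigma>" "s = abstract_sym c" using s by blast
      then have "s \<noteq> Semi" using D by (cases c) auto
      then consider "s = Zero" "xs = []" | x y where "x \<in> ?U" "y \<in> ?U" "s = Join" "xs = [x, y]"
        using args[OF xs(1)] xs(2) U by auto
      then show ?thesis
      proof cases
        case 1 then show ?thesis using SZ zero(2) by (simp add: B_def t_def)
      next
        case (2 x y)
        have "\<And>z. h z = h x \<union> h y \<Longrightarrow> t z = t x \<union> t y" unfolding t_def by blast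
        then show ?thesis using 2 join'[OF 2(1,2)] dis[of x y] by (auto simp: B_def)
      qed
    qed
    have "palg_iso (abstract_sym ` \<sigma>) t A B" "partial_algebra (abstract_sym ` \<sigma>) B"
      using palg_iso_image[OF pA inj_t uB op] by auto
    then have "palg_of_sets \<sigma> B" "palg_isomorphic (abstract_sym ` \<sigma>) A B"
      unfolding palg_of_sets_def palg_isomorphic_def B_def by auto
    then show ?thesis unfolding representable_def using pA D by blast
  next
    assume D: "DomDisjUnion \<in> \<sigma>"
    \<comment> \<open>All values are \<open>None\<close>, which lies outside every domain, so all compositions are empty.\<close>
    define t :: "'a \<Rightarrow> ('c option \<times> 'c option) set" where "t x = (\<lambda>u. (Some u, None)) ` h x" for x
    define B where "B = \<lparr>pa_univ = t ` ?U, pa_oper = pfun_oper\<rparr>"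
    have inj_t: "inj_on t (pa_univ A)"
      unfolding U t_def using inj
      by (intro inj_onI) (metis (no_types, lifting) Pair_inject inj_image_eq_iff inj_onD inj_onI option.inject)
    have uB: "pa_univ B = t ` pa_univ A" by (simp add: B_def U)
    have dis: "Domain (t x) \<inter> Domain (t y) = {} \<longleftrightarrow> h x \<inter> h y = {}" for x y unfolding t_def by auto
    have comp: "t x O t y = {}" for x y unfolding t_def by auto
    have t0: "t (fo_zero M) = {}" using zero(2) by (simp add: t_def)
    have op: "pa_oper B s (map t xs) = map_option t (pa_oper A s xs)"
      if xs: "length xs = arity s" "set xs \<subseteq> pa_univ A" for s xs
    proof -
      consider "s = Zero" "xs = []" | x y where "s = Semi" "xs = [x, y]"
        | x y where "x \<in> ?U" "y \<in> ?U" "s = Join" "xs = [x, y]"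
        using args[OF xs(1)] xs(2) U by auto
      then show ?thesis
      proof cases
        case 1 then show ?thesis using SZ t0 by (simp add: B_def)
      next
        case 2 then show ?thesis using SZ t0 comp by (simp add: B_def)
      next
        case (3 x y)
        have "\<And>z. h z = h x \<union> h y \<Longrightarrow> t z = t x \<union> t y" unfolding t_def by blast
        then show ?thesis using 3 join'[OF 3(1,2)] dis[of x y] by (auto simp: B_def)
      qed
    qed
    have "palg_iso (abstract_sym ` \<sigma>) t A B" "partial_algebra (abstract_sym ` \<sigma>) B"
      using palg_iso_image[OF pA inj_t uB op] by auto
    moreover have "single_valued (t x)" for x by (auto simp: t_def single_valued_def)
    ultimately have "palg_of_pfuns \<sigma> B" "palg_isomorphic (abstract_sym ` \<sigma>) A B"
      unfolding palg_of_pfuns_def palg_isomorphic_def B_def by auto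
    then show ?thesis unfolding representable_def using pA D by blast
  qed
  then show ?thesis unfolding representable_struct_def using str by blast
qed

lemma grid_representable:
  assumes f: "inj_on f (elems m n)" and mn: "n + 3 \<le> m" "3 \<le> n"
    and \<sigma>: "DisjUnion \<in> \<sigma> \<and> Compose \<notin> \<sigma> \<or> DomDisjUnion \<in> \<sigma>"
  shows "representable_struct TYPE((nat \<Rightarrow> nat) option) \<sigma> (grid_struct f m n)"
proof -
  define g where "g = the_inv_into (elems m n) f"
  have g: "g (f a) = a" if "a \<in> elems m n" for a
    unfolding g_def by (rule the_inv_into_f_f[OF f that])
  have U: "x \<in> fo_univ (grid_struct f m n) \<longleftrightarrow> (\<exists>a\<in>elems m n. x = f a)" for x
    by (auto simp: grid_struct_def)
  have mn': "3 \<le> m" "2 \<le> n" using mn by simp_all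
  have e: "{} \<in> elems m n" using empty_elem mn by simp
  show ?thesis
  proof (rule hom_representable_struct[OF \<sigma>, where h = "\<lambda>x. hit m n (g x)"])
    show "inj_on (\<lambda>x. hit m n (g x)) (fo_univ (grid_struct f m n))"
    proof (rule inj_onI)
      fix x y assume "x \<in> fo_univ (grid_struct f m n)" "y \<in> fo_univ (grid_struct f m n)"
        and eq: "hit m n (g x) = hit m n (g y)"
      then obtain a b where "a \<in> elems m n" "x = f a" "b \<in> elems m n" "y = f b" unfolding U by blast
      then show "x = y" using hit_subset[OF mn(1) mn'(2), of a b] hit_subset[OF mn(1) mn'(2), of b a] eq g by auto
    qed
  next
    fix x y z assume "x \<in> fo_univ (grid_struct f m n)" "y \<in> fo_univ (grid_struct f m n)"
      "z \<in> fo_univ (grid_struct f m n)" and J: "fo_J (grid_struct f m n) x y z"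
    then obtain a b c where abc: "a \<in> elems m n" "x = f a" "b \<in> elems m n" "y = f b" "c \<in> elems m n" "z = f c"
      unfolding U by blast
    then have "join m n a b c" using J grid_J[OF f] by blast
    then show "hit m n (g x) \<inter> hit m n (g y) = {} \<and> hit m n (g z) = hit m n (g x) \<union> hit m n (g y)"
      using hit_join[OF mn'(1) mn(2)] abc g by simp
  next
    fix x y assume "x \<in> fo_univ (grid_struct f m n)" "y \<in> fo_univ (grid_struct f m n)"
      and d: "hit m n (g x) \<inter> hit m n (g y) = {}"
    then obtain a b where ab: "a \<in> elems m n" "x = f a" "b \<in> elems m n" "y = f b" unfolding U by blast
    then obtain c where "c \<in> elems m n" "join m n a b c"
      using hit_disjoint_join[OF mn(1) mn'(2) ab(1,3)] d g by auto
    then show "\<exists>z\<in>fo_univ (grid_struct f m n). fo_J (grid_struct f m n) x y z"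
      using grid_J[OF f ab(1,3)] ab U by blast
  qed (use e g in \<open>auto simp: grid_struct_def hit_def\<close>)
qed

section \<open>Two grids that finitely many sentences cannot separate\<close>

lemma ex_inj_on_infinite:
  assumes "finite A" "infinite (UNIV :: 'a set)"
  shows "\<exists>f :: 'b \<Rightarrow> 'a. inj_on f A"
proof -
  obtain B :: "'a set" where "finite B" "card B = card A"
    using infinite_arbitrarily_large[OF assms(2)] by blast
  then show ?thesis using card_le_inj[OF assms(1), of B] by auto
qed

theorem corollary5p6:
  fixes \<sigma> :: "conc_sym set" and \<iota> :: "'a \<Rightarrow> 'b"
  assumes "infinite (UNIV :: 'a set)" and "inj \<iota>"
    and "\<sigma> \<in> {{DisjUnion}, {DomDisjUnion}, {DisjUnion, EmptySet}, {DomDisjUnion, EmptySet},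
               {DomDisjUnion, Compose}, {DomDisjUnion, Compose, EmptySet}}"
  shows "\<not> finitely_axiomatisable (abstract_sym ` \<sigma>)
           (\<lambda>M :: 'a fo_struct. representable_struct TYPE('b) \<sigma> M)"
proof
  assume "finitely_axiomatisable (abstract_sym ` \<sigma>)
    (\<lambda>M :: 'a fo_struct. representable_struct TYPE('b) \<sigma> M)"
  then obtain \<Phi> where \<Phi>: "finite \<Phi>" "\<And>\<phi>. \<phi> \<in> \<Phi> \<Longrightarrow> sentence (abstract_sym ` \<sigma>) \<phi>"
    and ax: "\<And>M :: 'a fo_struct. fo_structure (abstract_sym ` \<sigma>) M \<Longrightarrow>
       (\<forall>\<phi>\<in>\<Phi>. models M \<phi>) \<longleftrightarrow> representable_struct TYPE('b) \<sigma> M"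
    unfolding finitely_axiomatisable_def by blast
  have \<sigma>: "DisjUnion \<in> \<sigma> \<and> Compose \<notin> \<sigma> \<or> DomDisjUnion \<in> \<sigma>" "DisjUnion \<in> \<sigma> \<Longrightarrow> Compose \<notin> \<sigma>"
    "Join \<in> abstract_sym ` \<sigma>"
    using assms(3) by auto
  obtain k where k: "\<And>\<phi>. \<phi> \<in> \<Phi> \<Longrightarrow> qrank \<phi> \<le> k"
    using finite_imageI[OF \<Phi>(1), of qrank] unfolding finite_nat_set_iff_bounded_le by auto
  \<comment> \<open>The summand 1 ensures \<open>3 \<le> q\<close> even for
    \<open>k = 0\<close>.\<close>
  define q :: nat where "q = 2 ^ Suc k + 1"
  have q: "2 ^ Suc k \<le> q" "3 \<le> q" by (simp_all add: q_def)
  \<comment> \<open>Both grids have \<open>q + 1\<close> columns. With \<open>q + 4\<close> rows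
    there are exactly the three spare rows that the representation requires; with \<open>q\<close>
    rows there is one too few for an injection.\<close>
  obtain f :: "(nat \<times> nat) set \<Rightarrow> 'a" where f: "inj_on f (elems (q + 4) (q + 1))"
    using ex_inj_on_infinite[OF finite_elems assms(1)] by blast
  obtain f' :: "(nat \<times> nat) set \<Rightarrow> 'a" where f': "inj_on f' (elems q (q + 1))"
    using ex_inj_on_infinite[OF finite_elems assms(1)] by blast
  have str: "fo_structure (abstract_sym ` \<sigma>) (grid_struct g m n)" if "0 < m" for g :: "_ \<Rightarrow> 'a" and m n
    using empty_elem[OF that] by (simp add: fo_structure_def grid_struct_def)
  have "representable_struct TYPE((nat \<Rightarrow> nat) option) \<sigma> (grid_struct f (q + 4) (q + 1))"
    by (rule grid_representable[OF f _ _ \<sigma>(1)]) (use q in simp_all)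
  \<comment> \<open>The representation on placements uses a base type of its own and is moved to
    \<open>'b\<close>.\<close>
  then have "representable_struct TYPE('b) \<sigma> (grid_struct f (q + 4) (q + 1))"
    unfolding representable_struct_def
    using representable_base_irrelevant[OF assms(1,2) \<sigma>(2)] by blast
  then have "\<forall>\<phi>\<in>\<Phi>. models (grid_struct f (q + 4) (q + 1)) \<phi>"
    using ax[OF str] by simp
  moreover have "models (grid_struct f (q + 4) (q + 1)) \<phi> \<longleftrightarrow> models (grid_struct f' q (q + 1)) \<phi>"
    if "\<phi> \<in> \<Phi>" for \<phi>
    by (rule grid_models_iff[OF f f' _ _ _ _ \<Phi>(2)[OF that] k[OF that]]) (use q in simp_all)
  ultimately have "\<forall>\<phi>\<in>\<Phi>. models (grid_struct f' q (q + 1)) \<phi>" by blast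
  then have "representable_struct TYPE('b) \<sigma> (grid_struct f' q (q + 1))"
    using ax[OF str[of q f' "q + 1"]] q by simp
  then have "q + 1 \<le> q"
    using representable_grid_le[OF f' _ _ \<sigma>(3)] q by simp
  then show False by simp
qed

end
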